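(* Let $\star$ be the operad with one object and only one morphism (necessarily the identity), regarded as a non-symmetric or as a symmetric operad. The slice category $\mathbf{Ope}/\star$ (respectively $\mathbf{Ope}_\Sigma/\star$) is isomorphic to the category $\mathbf{Cat}$ of small categories, and, under this isomorphism, slicing the model structure on $\mathbf{Ope}$ (respectively $\mathbf{Ope}_\Sigma$) yields the Rezk model structure on $\mathbf{Cat}$.
   Context: Operads. A (non-symmetric) operad $\mathcal{P}$ (also called a multicategory, or coloured operad in sets) consists of a set $\mathrm{ob}(\mathcal{P})$ of objects; for all $n\ge 0$ and objects $p_0,\ldots,p_n$ a set $\mathcal{P}(p_1,\ldots,p_n;p_0)$ of morphisms; identities $\mathrm{id}_p\in\mathcal{P}(p;p)$; and an associative unital composition $\psi\circ(\psi_1,\ldots,\psi_n)$ (inputs concatenated). A symmetric operad is an operad equipped, for $\sigma\in\Sigma_n$, with functions $\sigma^*:\mathcal{P}(p_1,\ldots,p_n;p_0)\to\mathcal{P}(p_{\sigma(1)},\ldots,p_{\sigma(n)};p_0)$ forming an action of the symmetric groups and compatible with composition (the usual equivariance axioms). A functor of operads is a function on objects together with functions on morphism sets respecting composition and identities (and, in the symmetric case, the symmetric group actions). $\mathbf{Ope}$ and $\mathbf{Ope}_\Sigma$ are the resulting categories. $j^*(\mathcal{P})$ denotes the category of objects and unary morphisms of $\mathcal{P}$; an isomorphism in $\mathcal{P}$ is a unary morphism invertible in $j^*(\mathcal{P})$. All morphism sets of $\star$ other than the unary one are empty. Model structure on $\mathbf{Ope}$ and on $\mathbf{Ope}_\Sigma$.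 $F:\mathcal{P}\to\mathcal{Q}$ is a weak equivalence if $j^*(F)$ is essentially surjective and all functions $F:\mathcal{P}(p_1,\ldots,p_n;p_0)\to\mathcal{Q}(Fp_1,\ldots,Fp_n;Fp_0)$, $n\ge0$, are bijections; a cofibration if it is injective on objects; a fibration if for every $p\in\mathrm{ob}(\mathcal{P})$ and every isomorphism $\psi:Fp\to q$ in $\mathcal{Q}$ there is an isomorphism $\phi:p\to p'$ in $\mathcal{P}$ with $F\phi=\psi$. These classes form a Quillen model structure. Sliced model structure. For a model category $\mathcal{C}$ and an object $c$, the slice category $\mathcal{C}/c$ carries the model structure in which a morphism is a weak equivalence, fibration or cofibration if and only if its underlying morphism in $\mathcal{C}$ is one. Rezk model structure on $\mathbf{Cat}$. The weak equivalences are the equivalences of categories; the cofibrations are the functors injective on objects; the fibrations are the functors $F:\mathcal{C}\to\mathcal{D}$ such that for every object $C$ of $\mathcal{C}$ and every isomorphism $\psi:FC\to D$ in $\mathcal{D}$ there is an isomorphism $\phi:C\to C'$ in $\mathcal{C}$ with $F\phi=\psi$. *)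

theory Defs
  imports "HOL-Library.FuncSet" "HOL-Combinatorics.Permutations"
begin

text \<open>
  Categories and operads are given by a set of objects and a single set of morphisms with source
  and target maps, so that the morphism sets for different sources and targets are disjoint.
  Smallness means that objects and morphisms are taken from the types \<open>'o\<close> and \<open>'m\<close>, both arbitrary.

  The categories of operads and of small categories are to be compared up to isomorphism, not just
  up to equivalence. All structure maps, functors and functions are therefore required
  to be \<open>undefined\<close> outside of their domain: two structures (or functors) are then equal in
  HOL if and only if they are equal as mathematical objects.
\<close>

section \<open>Categories\<close>

record ('o, 'm) category =
  Obj :: "'o set"
  Arr :: "'m set"
  Dom :: "'m \<Rightarrow> 'o"
  Cod :: "'m \<Rightarrow> 'o"
  Ident :: "'o \<Rightarrow> 'm"
  Comp :: "'m \<Rightarrow> 'm \<Rightarrow> 'm"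

definition Hom :: "('o, 'm) category \<Rightarrow> 'o \<Rightarrow> 'o \<Rightarrow> 'm set" where
  "Hom C x y = {f \<in> Arr C. Dom C f = x \<and> Cod C f = y}"

text \<open>\<open>Comp C g f\<close> is the composite of \<open>g\<close> after \<open>f\<close>.\<close>

definition seq :: "('o, 'm) category \<Rightarrow> 'm \<Rightarrow> 'm \<Rightarrow> bool" where
  "seq C g f \<longleftrightarrow> g \<in> Arr C \<and> f \<in> Arr C \<and> Dom C g = Cod C f"

locale category =
  fixes C :: "('o, 'm) category"
  assumes Dom: "Dom C \<in> Arr C \<rightarrow>\<^sub>E Obj C"
    and Cod: "Cod C \<in> Arr C \<rightarrow>\<^sub>E Obj C"
    and Ident_ext: "Ident C \<in> extensional (Obj C)"
    and Ident: "x \<in> Obj C \<Longrightarrow> Ident C x \<in> Hom C x x"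
    and Comp_ext: "\<not> seq C g f \<Longrightarrow> Comp C g f = undefined"
    and Comp: "seq C g f \<Longrightarrow> Comp C g f \<in> Hom C (Dom C f) (Cod C g)"
    and Comp_Ident: "f \<in> Arr C \<Longrightarrow> Comp C f (Ident C (Dom C f)) = f"
    and Ident_Comp: "f \<in> Arr C \<Longrightarrow> Comp C (Ident C (Cod C f)) f = f"
    and Comp_assoc: "seq C h g \<Longrightarrow> seq C g f \<Longrightarrow> Comp C h (Comp C g f) = Comp C (Comp C h g) f"

definition inverse_arrows :: "('o, 'm) category \<Rightarrow> 'm \<Rightarrow> 'm \<Rightarrow> bool" where
  "inverse_arrows C f g \<longleftrightarrow> seq C f g \<and> seq C g f
     \<and> Comp C g f = Ident C (Dom C f) \<and> Comp C f g = Ident C (Cod C f)"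

definition iso :: "('o, 'm) category \<Rightarrow> 'm \<Rightarrow> bool" where
  "iso C f \<longleftrightarrow> (\<exists>g. inverse_arrows C f g)"

section \<open>Functors\<close>

text \<open>
  The underlying data of functors of categories as well as of functors of operads.
\<close>

record ('o, 'm, 'p, 'n) fctr =
  fob :: "'o \<Rightarrow> 'p"
  far :: "'m \<Rightarrow> 'n"

definition fctr_id :: "'o set \<Rightarrow> 'm set \<Rightarrow> ('o, 'm, 'o, 'm) fctr" where
  "fctr_id A M = \<lparr>fob = (\<lambda>x\<in>A. x), far = (\<lambda>f\<in>M. f)\<rparr>"

definition fctr_comp :: "'o set \<Rightarrow> 'm set \<Rightarrow> ('p, 'n, 'q, 'k) fctr \<Rightarrow> ('o, 'm, 'p, 'n) fctr
    \<Rightarrow> ('o, 'm, 'q, 'k) fctr" where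
  "fctr_comp A M G F = \<lparr>fob = (\<lambda>x\<in>A. fob G (fob F x)), far = (\<lambda>f\<in>M. far G (far F f))\<rparr>"

definition is_functor ::
    "('o, 'm) category \<Rightarrow> ('p, 'n) category \<Rightarrow> ('o, 'm, 'p, 'n) fctr \<Rightarrow> bool" where
  "is_functor C D F \<longleftrightarrow>
     fob F \<in> Obj C \<rightarrow>\<^sub>E Obj D \<and> far F \<in> Arr C \<rightarrow>\<^sub>E Arr D
     \<and> (\<forall>f\<in>Arr C. Dom D (far F f) = fob F (Dom C f) \<and> Cod D (far F f) = fob F (Cod C f))
     \<and> (\<forall>x\<in>Obj C. far F (Ident C x) = Ident D (fob F x))
     \<and> (\<forall>g f. seq C g f \<longrightarrow> far F (Comp C g f) = Comp D (far F g) (far F f))"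

definition isomorphism_of_categories ::
    "('o, 'm) category \<Rightarrow> ('p, 'n) category \<Rightarrow> ('o, 'm, 'p, 'n) fctr \<Rightarrow> bool" where
  "isomorphism_of_categories C D F \<longleftrightarrow> category C \<and> category D \<and> is_functor C D F
     \<and> (\<exists>G. is_functor D C G
          \<and> fctr_comp (Obj C) (Arr C) G F = fctr_id (Obj C) (Arr C)
          \<and> fctr_comp (Obj D) (Arr D) F G = fctr_id (Obj D) (Arr D))"

definition natural_isomorphism :: "('o, 'm) category \<Rightarrow> ('p, 'n) category
    \<Rightarrow> ('o, 'm, 'p, 'n) fctr \<Rightarrow> ('o, 'm, 'p, 'n) fctr \<Rightarrow> ('o \<Rightarrow> 'n) \<Rightarrow> bool" where
  "natural_isomorphism C D F G \<eta> \<longleftrightarrow>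
     (\<forall>x\<in>Obj C. \<eta> x \<in> Hom D (fob F x) (fob G x) \<and> iso D (\<eta> x))
     \<and> (\<forall>f\<in>Arr C. Comp D (far G f) (\<eta> (Dom C f)) = Comp D (\<eta> (Cod C f)) (far F f))"

definition equivalence_of_categories ::
    "('o, 'm) category \<Rightarrow> ('p, 'n) category \<Rightarrow> ('o, 'm, 'p, 'n) fctr \<Rightarrow> bool" where
  "equivalence_of_categories C D F \<longleftrightarrow> is_functor C D F
     \<and> (\<exists>G \<eta> \<epsilon>. is_functor D C G
          \<and> natural_isomorphism C C (fctr_id (Obj C) (Arr C)) (fctr_comp (Obj C) (Arr C) G F) \<eta>
          \<and> natural_isomorphism D D (fctr_comp (Obj D) (Arr D) F G) (fctr_id (Obj D) (Arr D)) \<epsilon>)"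

definition essentially_surjective ::
    "('o, 'm) category \<Rightarrow> ('p, 'n) category \<Rightarrow> ('o, 'm, 'p, 'n) fctr \<Rightarrow> bool" where
  "essentially_surjective C D F \<longleftrightarrow> (\<forall>d\<in>Obj D. \<exists>c\<in>Obj C. \<exists>\<psi>\<in>Hom D (fob F c) d. iso D \<psi>)"

text \<open>
  The category of all structures in a class \<open>S\<close> (with object set \<open>ob X\<close> and morphism set
  \<open>mor X\<close>), whose morphisms from \<open>X\<close> to \<open>Y\<close> are the triples \<open>(X, F, Y)\<close> with \<open>H X Y F\<close>.
\<close>

definition structure_category :: "'s set \<Rightarrow> ('s \<Rightarrow> 'o set) \<Rightarrow> ('s \<Rightarrow> 'm set)
    \<Rightarrow> ('s \<Rightarrow> 's \<Rightarrow> ('o, 'm, 'o, 'm) fctr \<Rightarrow> bool)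
    \<Rightarrow> ('s, 's \<times> ('o, 'm, 'o, 'm) fctr \<times> 's) category" where
  "structure_category S ob mor H =
     (let A = {(X, F, Y). X \<in> S \<and> Y \<in> S \<and> H X Y F} in
      \<lparr>Obj = S,
       Arr = A,
       Dom = (\<lambda>(X, F, Y)\<in>A. X),
       Cod = (\<lambda>(X, F, Y)\<in>A. Y),
       Ident = (\<lambda>X\<in>S. (X, fctr_id (ob X) (mor X), X)),
       Comp = (\<lambda>(Y', G, Z) (X, F, Y).
         if (Y', G, Z) \<in> A \<and> (X, F, Y) \<in> A \<and> Y' = Y
         then (X, fctr_comp (ob X) (mor X) G F, Z) else undefined)\<rparr>)"

definition Cat :: "(('o, 'm) category,
    ('o, 'm) category \<times> ('o, 'm, 'o, 'm) fctr \<times> ('o, 'm) category) category" where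
  "Cat = structure_category {C. category C} Obj Arr is_functor"

text \<open>An object \<open>x \<rightarrow> c\<close> of the slice category is represented by the arrow alone, as it determines \<open>x\<close>.\<close>

definition slice :: "('o, 'm) category \<Rightarrow> 'o \<Rightarrow> ('m, 'm \<times> 'm \<times> 'm) category" where
  "slice C c =
     (let B = {p \<in> Arr C. Cod C p = c};
          A = {(p, f, q). p \<in> B \<and> q \<in> B \<and> f \<in> Hom C (Dom C p) (Dom C q) \<and> Comp C q f = p} in
      \<lparr>Obj = B,
       Arr = A,
       Dom = (\<lambda>(p, f, q)\<in>A. p),
       Cod = (\<lambda>(p, f, q)\<in>A. q),
       Ident = (\<lambda>p\<in>B. (p, Ident C (Dom C p), p)),
       Comp = (\<lambda>(q', g, r) (p, f, q).
         if (q', g, r) \<in> A \<and> (p, f, q) \<in> A \<and> q' = q then (p, Comp C g f, r) else undefined)\<rparr>)"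

section \<open>Model structures\<close>

record 'm model_classes =
  weq :: "'m set"
  cof :: "'m set"
  fib :: "'m set"

definition has_lifting :: "('o, 'm) category \<Rightarrow> 'm \<Rightarrow> 'm \<Rightarrow> bool" where
  "has_lifting C i p \<longleftrightarrow>
     (\<forall>u\<in>Hom C (Dom C i) (Dom C p). \<forall>v\<in>Hom C (Cod C i) (Cod C p).
        Comp C p u = Comp C v i \<longrightarrow>
        (\<exists>h\<in>Hom C (Cod C i) (Dom C p). Comp C h i = u \<and> Comp C p h = v))"

definition retract_of :: "('o, 'm) category \<Rightarrow> 'm \<Rightarrow> 'm \<Rightarrow> bool" where
  "retract_of C f g \<longleftrightarrow>
     (\<exists>i\<in>Hom C (Dom C f) (Dom C g). \<exists>r\<in>Hom C (Dom C g) (Dom C f).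
      \<exists>j\<in>Hom C (Cod C f) (Cod C g). \<exists>s\<in>Hom C (Cod C g) (Cod C f).
        Comp C r i = Ident C (Dom C f) \<and> Comp C s j = Ident C (Cod C f)
        \<and> Comp C g i = Comp C j f \<and> Comp C f r = Comp C s g)"

text \<open>
  Quillen's axioms on the three classes of morphisms (closed form), for a model structure on a
  category; existence of limits and colimits is a property of the category only and not part of this.
\<close>

locale model_structure = category C for C :: "('o, 'm) category" +
  fixes M :: "'m model_classes"
  assumes classes: "weq M \<subseteq> Arr C" "cof M \<subseteq> Arr C" "fib M \<subseteq> Arr C"
    and two_of_three: "seq C g f \<Longrightarrow> f \<in> weq M \<Longrightarrow> g \<in> weq M \<Longrightarrow> Comp C g f \<in> weq M"
      "seq C g f \<Longrightarrow> f \<in> weq M \<Longrightarrow> Comp C g f \<in> weq M \<Longrightarrow> g \<in> weq M"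
      "seq C g f \<Longrightarrow> g \<in> weq M \<Longrightarrow> Comp C g f \<in> weq M \<Longrightarrow> f \<in> weq M"
    and retracts: "f \<in> Arr C \<Longrightarrow> retract_of C f g \<Longrightarrow> g \<in> weq M \<Longrightarrow> f \<in> weq M"
      "f \<in> Arr C \<Longrightarrow> retract_of C f g \<Longrightarrow> g \<in> cof M \<Longrightarrow> f \<in> cof M"
      "f \<in> Arr C \<Longrightarrow> retract_of C f g \<Longrightarrow> g \<in> fib M \<Longrightarrow> f \<in> fib M"
    and lifting: "i \<in> cof M \<Longrightarrow> p \<in> fib M \<Longrightarrow> i \<in> weq M \<or> p \<in> weq M \<Longrightarrow> has_lifting C i p"
    and factorization:
      "f \<in> Arr C \<Longrightarrow> \<exists>p i. seq C p i \<and> f = Comp C p i \<and> i \<in> cof M \<inter> weq M \<and> p \<in> fib M"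
      "f \<in> Arr C \<Longrightarrow> \<exists>p i. seq C p i \<and> f = Comp C p i \<and> i \<in> cof M \<and> p \<in> fib M \<inter> weq M"

definition slice_classes ::
    "('o, 'm) category \<Rightarrow> 'o \<Rightarrow> 'm model_classes \<Rightarrow> ('m \<times> 'm \<times> 'm) model_classes" where
  "slice_classes C c M =
     \<lparr>weq = {(p, f, q) \<in> Arr (slice C c). f \<in> weq M},
      cof = {(p, f, q) \<in> Arr (slice C c). f \<in> cof M},
      fib = {(p, f, q) \<in> Arr (slice C c). f \<in> fib M}\<rparr>"

definition image_classes :: "('o, 'm, 'p, 'n) fctr \<Rightarrow> 'm model_classes \<Rightarrow> 'n model_classes" where
  "image_classes F M = \<lparr>weq = far F ` weq M, cof = far F ` cof M, fib = far F ` fib M\<rparr>"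

definition isofibration ::
    "('o, 'm) category \<Rightarrow> ('p, 'n) category \<Rightarrow> ('o, 'm, 'p, 'n) fctr \<Rightarrow> bool" where
  "isofibration C D F \<longleftrightarrow>
     (\<forall>x\<in>Obj C. \<forall>\<psi>. iso D \<psi> \<and> Dom D \<psi> = fob F x \<longrightarrow>
        (\<exists>\<phi>. iso C \<phi> \<and> Dom C \<phi> = x \<and> far F \<phi> = \<psi>))"

definition Rezk_classes ::
    "(('o, 'm) category \<times> ('o, 'm, 'o, 'm) fctr \<times> ('o, 'm) category) model_classes" where
  "Rezk_classes =
     \<lparr>weq = {(C, F, D) \<in> Arr Cat. equivalence_of_categories C D F},
      cof = {(C, F, D) \<in> Arr Cat. inj_on (fob F) (Obj C)},
      fib = {(C, F, D) \<in> Arr Cat. isofibration C D F}\<rparr>"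

section \<open>Operads\<close>

record ('o, 'm) operad =
  Ob :: "'o set"
  Mor :: "'m set"
  src :: "'m \<Rightarrow> 'o list"
  tgt :: "'m \<Rightarrow> 'o"
  idn :: "'o \<Rightarrow> 'm"
  cmp :: "'m \<Rightarrow> 'm list \<Rightarrow> 'm"

definition MHom :: "('o, 'm, 'x) operad_scheme \<Rightarrow> 'o list \<Rightarrow> 'o \<Rightarrow> 'm set" where
  "MHom P ps p = {f \<in> Mor P. src P f = ps \<and> tgt P f = p}"

definition mseq :: "('o, 'm, 'x) operad_scheme \<Rightarrow> 'm \<Rightarrow> 'm list \<Rightarrow> bool" where
  "mseq P f gs \<longleftrightarrow> f \<in> Mor P \<and> set gs \<subseteq> Mor P \<and> map (tgt P) gs = src P f"

locale operad =
  fixes P :: "('o, 'm, 'x) operad_scheme"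
  assumes src: "src P \<in> Mor P \<rightarrow>\<^sub>E lists (Ob P)"
    and tgt: "tgt P \<in> Mor P \<rightarrow>\<^sub>E Ob P"
    and idn_ext: "idn P \<in> extensional (Ob P)"
    and idn: "p \<in> Ob P \<Longrightarrow> idn P p \<in> MHom P [p] p"
    and cmp_ext: "\<not> mseq P f gs \<Longrightarrow> cmp P f gs = undefined"
    and cmp: "mseq P f gs \<Longrightarrow> cmp P f gs \<in> MHom P (concat (map (src P) gs)) (tgt P f)"
    and cmp_idn: "f \<in> Mor P \<Longrightarrow> cmp P f (map (idn P) (src P f)) = f"
    and idn_cmp: "f \<in> Mor P \<Longrightarrow> cmp P (idn P (tgt P f)) [f] = f"
    and cmp_assoc: "mseq P f gs \<Longrightarrow> list_all2 (mseq P) gs hss \<Longrightarrow>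
      cmp P f (map2 (cmp P) gs hss) = cmp P (cmp P f gs) (concat hss)"

text \<open>
  A permutation in \<open>\<Sigma>\<^sub>n\<close> is a function \<open>\<sigma>\<close> with \<open>\<sigma> permutes {..<n}\<close>; positions are counted from \<open>0\<close>.
  By definition, entry number \<open>i\<close> of \<open>permute_list \<sigma> ps\<close> is \<open>ps ! \<sigma> i\<close>, so that \<open>\<sigma>\<^sup>*\<close> replaces the source
  \<open>ps\<close> by \<open>permute_list \<sigma> ps\<close>.
\<close>

record ('o, 'm) sym_operad = "('o, 'm) operad" +
  act :: "(nat \<Rightarrow> nat) \<Rightarrow> 'm \<Rightarrow> 'm"

text \<open>The partition of \<open>[0..<sum_list ks]\<close> into consecutive intervals of lengths given by \<open>ks\<close>.\<close>

definition blocks :: "nat list \<Rightarrow> nat list list" where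
  "blocks ks = map (\<lambda>i. [sum_list (take i ks)..<sum_list (take (Suc i) ks)]) [0..<length ks]"

text \<open>The permutation of \<open>{..<sum_list ks}\<close> which permutes these blocks according to \<open>\<sigma>\<close>.\<close>

definition block_perm :: "(nat \<Rightarrow> nat) \<Rightarrow> nat list \<Rightarrow> nat \<Rightarrow> nat" where
  "block_perm \<sigma> ks m =
     (if m < sum_list ks then concat (permute_list \<sigma> (blocks ks)) ! m else m)"

text \<open>The permutation which acts on block number \<open>i\<close> as the permutation \<open>\<tau>s ! i\<close> in \<open>\<Sigma>\<close> of \<open>ks ! i\<close>.\<close>

definition sum_perm :: "(nat \<Rightarrow> nat) list \<Rightarrow> nat list \<Rightarrow> nat \<Rightarrow> nat" where
  "sum_perm \<tau>s ks m =
     (if m < sum_list ks then concat (map2 permute_list \<tau>s (blocks ks)) ! m else m)"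

definition arity :: "('o, 'm, 'x) operad_scheme \<Rightarrow> 'm \<Rightarrow> nat" where
  "arity P f = length (src P f)"

definition acts :: "('o, 'm, 'x) operad_scheme \<Rightarrow> (nat \<Rightarrow> nat) \<Rightarrow> 'm \<Rightarrow> bool" where
  "acts P \<sigma> f \<longleftrightarrow> f \<in> Mor P \<and> \<sigma> permutes {..<arity P f}"

locale sym_operad = operad P for P :: "('o, 'm, 'x) sym_operad_scheme" +
  assumes act_ext: "\<not> acts P \<sigma> f \<Longrightarrow> act P \<sigma> f = undefined"
    and act: "acts P \<sigma> f \<Longrightarrow> act P \<sigma> f \<in> MHom P (permute_list \<sigma> (src P f)) (tgt P f)"
    and act_id: "f \<in> Mor P \<Longrightarrow> act P id f = f"
    and act_act: "acts P \<sigma> f \<Longrightarrow> acts P \<tau> f \<Longrightarrow> act P \<tau> (act P \<sigma> f) = act P (\<sigma> \<circ> \<tau>) f"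
    and act_cmp: "mseq P f gs \<Longrightarrow> acts P \<sigma> f \<Longrightarrow>
      cmp P (act P \<sigma> f) (permute_list \<sigma> gs) = act P (block_perm \<sigma> (map (arity P) gs)) (cmp P f gs)"
    and cmp_act: "mseq P f gs \<Longrightarrow> list_all2 (acts P) \<tau>s gs \<Longrightarrow>
      cmp P f (map2 (act P) \<tau>s gs) = act P (sum_perm \<tau>s (map (arity P) gs)) (cmp P f gs)"

definition operad_functor ::
    "('o, 'm, 'x) operad_scheme \<Rightarrow> ('p, 'n, 'y) operad_scheme \<Rightarrow> ('o, 'm, 'p, 'n) fctr \<Rightarrow> bool" where
  "operad_functor P Q F \<longleftrightarrow>
     fob F \<in> Ob P \<rightarrow>\<^sub>E Ob Q \<and> far F \<in> Mor P \<rightarrow>\<^sub>E Mor Q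
     \<and> (\<forall>f\<in>Mor P. src Q (far F f) = map (fob F) (src P f) \<and> tgt Q (far F f) = fob F (tgt P f))
     \<and> (\<forall>p\<in>Ob P. far F (idn P p) = idn Q (fob F p))
     \<and> (\<forall>f gs. mseq P f gs \<longrightarrow> far F (cmp P f gs) = cmp Q (far F f) (map (far F) gs))"

definition sym_operad_functor ::
    "('o, 'm, 'x) sym_operad_scheme \<Rightarrow> ('p, 'n, 'y) sym_operad_scheme \<Rightarrow> ('o, 'm, 'p, 'n) fctr
      \<Rightarrow> bool" where
  "sym_operad_functor P Q F \<longleftrightarrow> operad_functor P Q F
     \<and> (\<forall>\<sigma> f. acts P \<sigma> f \<longrightarrow> far F (act P \<sigma> f) = act Q \<sigma> (far F f))"

definition Ope :: "(('o, 'm) operad,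
    ('o, 'm) operad \<times> ('o, 'm, 'o, 'm) fctr \<times> ('o, 'm) operad) category" where
  "Ope = structure_category {P. operad P} Ob Mor operad_functor"

definition Ope_Sigma :: "(('o, 'm) sym_operad,
    ('o, 'm) sym_operad \<times> ('o, 'm, 'o, 'm) fctr \<times> ('o, 'm) sym_operad) category" where
  "Ope_Sigma = structure_category {P. sym_operad P} Ob Mor sym_operad_functor"

text \<open>The category \<open>j\<^sup>*(P)\<close> of objects and unary morphisms, and the functor \<open>j\<^sup>*(F)\<close> for \<open>F\<close> defined on \<open>P\<close>.\<close>

definition unary :: "('o, 'm, 'x) operad_scheme \<Rightarrow> 'm set" where
  "unary P = {f \<in> Mor P. arity P f = 1}"

definition jstar :: "('o, 'm, 'x) operad_scheme \<Rightarrow> ('o, 'm) category" where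
  "jstar P =
     \<lparr>Obj = Ob P,
      Arr = unary P,
      Dom = (\<lambda>f\<in>unary P. hd (src P f)),
      Cod = (\<lambda>f\<in>unary P. tgt P f),
      Ident = idn P,
      Comp = (\<lambda>g f. if g \<in> unary P \<and> f \<in> unary P \<and> src P g = [tgt P f]
                    then cmp P g [f] else undefined)\<rparr>"

definition jstar_fctr ::
    "('o, 'm, 'x) operad_scheme \<Rightarrow> ('o, 'm, 'p, 'n) fctr \<Rightarrow> ('o, 'm, 'p, 'n) fctr" where
  "jstar_fctr P F = \<lparr>fob = fob F, far = (\<lambda>f\<in>unary P. far F f)\<rparr>"

definition operad_weq ::
    "('o, 'm, 'x) operad_scheme \<Rightarrow> ('p, 'n, 'y) operad_scheme \<Rightarrow> ('o, 'm, 'p, 'n) fctr \<Rightarrow> bool" where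
  "operad_weq P Q F \<longleftrightarrow> essentially_surjective (jstar P) (jstar Q) (jstar_fctr P F)
     \<and> (\<forall>ps\<in>lists (Ob P). \<forall>p\<in>Ob P.
          bij_betw (far F) (MHom P ps p) (MHom Q (map (fob F) ps) (fob F p)))"

text \<open>Isomorphisms in an operad are by definition those in its category of unary morphisms.\<close>

definition operad_fib ::
    "('o, 'm, 'x) operad_scheme \<Rightarrow> ('p, 'n, 'y) operad_scheme \<Rightarrow> ('o, 'm, 'p, 'n) fctr \<Rightarrow> bool" where
  "operad_fib P Q F \<longleftrightarrow>
     (\<forall>p\<in>Ob P. \<forall>\<psi>. iso (jstar Q) \<psi> \<and> src Q \<psi> = [fob F p] \<longrightarrow>
        (\<exists>\<phi>. iso (jstar P) \<phi> \<and> src P \<phi> = [p] \<and> far F \<phi> = \<psi>))"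

definition Ope_classes ::
    "(('o, 'm) operad \<times> ('o, 'm, 'o, 'm) fctr \<times> ('o, 'm) operad) model_classes" where
  "Ope_classes =
     \<lparr>weq = {(P, F, Q) \<in> Arr Ope. operad_weq P Q F},
      cof = {(P, F, Q) \<in> Arr Ope. inj_on (fob F) (Ob P)},
      fib = {(P, F, Q) \<in> Arr Ope. operad_fib P Q F}\<rparr>"

definition Ope_Sigma_classes ::
    "(('o, 'm) sym_operad \<times> ('o, 'm, 'o, 'm) fctr \<times> ('o, 'm) sym_operad) model_classes" where
  "Ope_Sigma_classes =
     \<lparr>weq = {(P, F, Q) \<in> Arr Ope_Sigma. operad_weq P Q F},
      cof = {(P, F, Q) \<in> Arr Ope_Sigma. inj_on (fob F) (Ob P)},
      fib = {(P, F, Q) \<in> Arr Ope_Sigma. operad_fib P Q F}\<rparr>"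

section \<open>The operad with one object and one morphism\<close>

text \<open>The names \<open>a\<close> of the object and \<open>u\<close> of the morphism are arbitrary.\<close>

definition star :: "'o \<Rightarrow> 'm \<Rightarrow> ('o, 'm) operad" where
  "star a u =
     \<lparr>Ob = {a}, Mor = {u}, src = (\<lambda>f\<in>{u}. [a]), tgt = (\<lambda>f\<in>{u}. a), idn = (\<lambda>p\<in>{a}. u),
      cmp = (\<lambda>f gs. if f = u \<and> gs = [u] then u else undefined)\<rparr>"

definition sym_star :: "'o \<Rightarrow> 'm \<Rightarrow> ('o, 'm) sym_operad" where
  "sym_star a u = operad.extend (star a u)
     \<lparr>act = (\<lambda>\<sigma> f. if f = u \<and> \<sigma> permutes {..<1} then u else undefined)\<rparr>"

text \<open>
  The functor \<open>j\<^sup>*\<close> from the slice of a category \<open>K\<close> of operads over \<open>c\<close> to the category of small categories,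
  sending \<open>P \<rightarrow> c\<close> to \<open>j\<^sup>*(P)\<close> and a morphism \<open>F\<close> over \<open>c\<close> to \<open>j\<^sup>*(F)\<close>.
\<close>

definition slice_jstar :: "(('o, 'm, 'x) operad_scheme,
      ('o, 'm, 'x) operad_scheme \<times> ('o, 'm, 'o, 'm) fctr \<times> ('o, 'm, 'x) operad_scheme) category
    \<Rightarrow> ('o, 'm, 'x) operad_scheme
    \<Rightarrow> (('o, 'm, 'x) operad_scheme \<times> ('o, 'm, 'o, 'm) fctr \<times> ('o, 'm, 'x) operad_scheme,
        (('o, 'm, 'x) operad_scheme \<times> ('o, 'm, 'o, 'm) fctr \<times> ('o, 'm, 'x) operad_scheme)
        \<times> (('o, 'm, 'x) operad_scheme \<times> ('o, 'm, 'o, 'm) fctr \<times> ('o, 'm, 'x) operad_scheme)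
        \<times> (('o, 'm, 'x) operad_scheme \<times> ('o, 'm, 'o, 'm) fctr \<times> ('o, 'm, 'x) operad_scheme),
        ('o, 'm) category,
        ('o, 'm) category \<times> ('o, 'm, 'o, 'm) fctr \<times> ('o, 'm) category) fctr" where
  "slice_jstar K c =
     \<lparr>fob = (\<lambda>(P, _, _)\<in>Obj (slice K c). jstar P),
      far = (\<lambda>(_, (P, F, Q), _)\<in>Arr (slice K c). (jstar P, jstar_fctr P F, jstar Q))\<rparr>"

end

theory Submission
  imports Defs
begin

text \<open>
  The operad with one object and one morphism is called the point here. A functor of operads preserves
  arities, and the only morphism of the point is unary. Hence an operad over the point has unary
  operations only, and conversely such an operad has exactly one functor to the point
  (\<open>all_unary_if_functor\<close>, \<open>is_functor_point_iff\<close>). An operad with only unary operations is the same as a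
  category: \<open>jstar\<close> is inverse to the construction which regards arrows as unary operations
  (\<open>operad_of_category_jstar\<close>, \<open>jstar_operad_of_category\<close>), and functors of operads correspond to
  functors (\<open>operad_functor_iff_is_functor\<close>). In the symmetric case, \<open>\<Sigma>\<^sub>1\<close> is trivial and acts in just
  one way (\<open>sym_operad_of_category_jstar\<close>). The slice category is thus isomorphic to \<open>Cat\<close> by \<open>jstar\<close>.

  Under this isomorphism, cofibrations and fibrations are described by the same conditions on both
  sides. A weak equivalence of operads becomes a functor which is essentially surjective and
  bijective on unary morphism sets, all other morphism sets being empty, and these functors are the
  equivalences of categories (\<open>equivalence_iff_fully_faithful\<close>).

  Moreover, a model structure passes to slice categories (\<open>model_structure_slice\<close>) and along
  isomorphisms of categories (\<open>model_structure_image\<close>). The argument needs only a few properties of a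
  category of operads, which are collected in the locale \<open>operads_over_point\<close> and hold for operads and
  for symmetric operads.
\<close>

section \<open>Arrows in a category\<close>

lemma HomI: "f \<in> Arr C \<Longrightarrow> Dom C f = x \<Longrightarrow> Cod C f = y \<Longrightarrow> f \<in> Hom C x y"
  by (simp add: Hom_def)

lemma HomD:
  assumes "f \<in> Hom C x y"
  shows "f \<in> Arr C" "Dom C f = x" "Cod C f = y"
  using assms by (simp_all add: Hom_def)

lemma seq_Hom: "g \<in> Hom C y z \<Longrightarrow> f \<in> Hom C x y \<Longrightarrow> seq C g f"
  by (simp add: Hom_def seq_def)

context category
begin

lemma Dom_Obj: "f \<in> Arr C \<Longrightarrow> Dom C f \<in> Obj C"
  using Dom by auto

lemma Cod_Obj: "f \<in> Arr C \<Longrightarrow> Cod C f \<in> Obj C"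
  using Cod by auto

lemma Hom_Obj:
  assumes "f \<in> Hom C x y"
  shows "x \<in> Obj C" "y \<in> Obj C"
  using assms Dom_Obj Cod_Obj by (auto simp: Hom_def)

lemma Comp_Hom: "g \<in> Hom C y z \<Longrightarrow> f \<in> Hom C x y \<Longrightarrow> Comp C g f \<in> Hom C x z"
  using Comp[OF seq_Hom] by (simp add: Hom_def)

lemma Comp_Ident_Hom: "f \<in> Hom C x y \<Longrightarrow> Comp C f (Ident C x) = f"
  using Comp_Ident by (auto simp: Hom_def)

lemma Ident_Comp_Hom: "f \<in> Hom C x y \<Longrightarrow> Comp C (Ident C y) f = f"
  using Ident_Comp by (auto simp: Hom_def)

lemma assoc_Hom:
  "h \<in> Hom C y z \<Longrightarrow> g \<in> Hom C x y \<Longrightarrow> f \<in> Hom C w x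
    \<Longrightarrow> Comp C (Comp C h g) f = Comp C h (Comp C g f)"
  using Comp_assoc[OF seq_Hom seq_Hom] by metis

lemma iso_Arr: "iso C f \<Longrightarrow> f \<in> Arr C"
  by (auto simp: iso_def inverse_arrows_def seq_def)

lemma iso_Hom_iff:
  assumes "f \<in> Hom C x y"
  shows "iso C f \<longleftrightarrow> (\<exists>g\<in>Hom C y x. Comp C g f = Ident C x \<and> Comp C f g = Ident C y)"
  using assms unfolding iso_def inverse_arrows_def Hom_def seq_def by fastforce

lemma iso_cancel_left:
  assumes "iso C k" "k \<in> Hom C y z" "f \<in> Hom C x y" "g \<in> Hom C x y" "Comp C k f = Comp C k g"
  shows "f = g"
proof -
  obtain k' where k': "k' \<in> Hom C z y" "Comp C k' k = Ident C y"
    using iso_Hom_iff assms by blast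
  have "Comp C (Comp C k' k) f = Comp C (Comp C k' k) g"
    using assms k'(1) by (metis assoc_Hom)
  then show ?thesis
    using assms k' by (simp add: Ident_Comp_Hom)
qed

lemma iso_cancel_right:
  assumes "iso C k" "k \<in> Hom C x y" "f \<in> Hom C y z" "g \<in> Hom C y z" "Comp C f k = Comp C g k"
  shows "f = g"
proof -
  obtain k' where k': "k' \<in> Hom C y x" "Comp C k k' = Ident C y"
    using iso_Hom_iff assms by blast
  have "Comp C f (Comp C k k') = Comp C g (Comp C k k')"
    using assms k' by (metis assoc_Hom)
  then show ?thesis
    using assms k' by (simp add: Comp_Ident_Hom)
qed

end

section \<open>Functors\<close>

lemma is_functor_Obj: "is_functor C D F \<Longrightarrow> x \<in> Obj C \<Longrightarrow> fob F x \<in> Obj D"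
  by (auto simp: is_functor_def)

lemma is_functor_Arr: "is_functor C D F \<Longrightarrow> f \<in> Arr C \<Longrightarrow> far F f \<in> Arr D"
  by (auto simp: is_functor_def)

lemma is_functor_Hom:
  "is_functor C D F \<Longrightarrow> f \<in> Hom C x y \<Longrightarrow> far F f \<in> Hom D (fob F x) (fob F y)"
  by (auto simp: is_functor_def Hom_def)

lemma is_functor_Comp:
  "is_functor C D F \<Longrightarrow> g \<in> Hom C y z \<Longrightarrow> f \<in> Hom C x y
    \<Longrightarrow> far F (Comp C g f) = Comp D (far F g) (far F f)"
  using seq_Hom by (fastforce simp: is_functor_def)

lemma is_functor_Ident: "is_functor C D F \<Longrightarrow> x \<in> Obj C \<Longrightarrow> far F (Ident C x) = Ident D (fob F x)"
  by (auto simp: is_functor_def)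

lemma fctr_id_simps [simp]:
  "fob (fctr_id A M) = (\<lambda>x\<in>A. x)" "far (fctr_id A M) = (\<lambda>f\<in>M. f)"
  by (simp_all add: fctr_id_def)

lemma fctr_comp_simps [simp]:
  "fob (fctr_comp A M G F) = (\<lambda>x\<in>A. fob G (fob F x))"
  "far (fctr_comp A M G F) = (\<lambda>f\<in>M. far G (far F f))"
  by (simp_all add: fctr_comp_def)

lemma fctr_eqI:
  fixes F G :: "('o, 'm, 'p, 'n) fctr"
  assumes "fob F \<in> extensional A" "fob G \<in> extensional A" "\<And>x. x \<in> A \<Longrightarrow> fob F x = fob G x"
    and "far F \<in> extensional M" "far G \<in> extensional M" "\<And>f. f \<in> M \<Longrightarrow> far F f = far G f"
  shows "F = G"
proof (rule fctr.equality)
  show "fob F = fob G" using assms(1-3) by (rule extensionalityI)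
  show "far F = far G" using assms(4-6) by (rule extensionalityI)
qed simp

lemma is_functor_id:
  assumes "category C"
  shows "is_functor C C (fctr_id (Obj C) (Arr C))"
proof -
  interpret category C by fact
  show ?thesis
    using Dom_Obj Cod_Obj Ident Comp by (auto simp: is_functor_def Hom_def seq_def)
qed

lemma is_functor_comp:
  assumes "category C" "is_functor C D F" "is_functor D E G"
  shows "is_functor C E (fctr_comp (Obj C) (Arr C) G F)"
proof -
  interpret category C by fact
  show ?thesis
    using assms(2,3) Dom_Obj Cod_Obj Ident Comp
    by (auto simp: is_functor_def Hom_def seq_def Pi_iff PiE_iff)
qed

text \<open>
  A functor that is bijective on objects and on arrows is inverted by the inverse functions; these
  preserve composites since every composite in the target is the image of one in the source.
\<close>

lemma isomorphism_of_categories_if_bij: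
  assumes C: "category C" and D: "category D" and F: "is_functor C D F"
    and ob: "bij_betw (fob F) (Obj C) (Obj D)" and ar: "bij_betw (far F) (Arr C) (Arr D)"
  shows "isomorphism_of_categories C D F"
proof -
  interpret C: category C by fact
  interpret D: category D by fact
  define G where "G = \<lparr>fob = (\<lambda>x\<in>Obj D. inv_into (Obj C) (fob F) x),
    far = (\<lambda>f\<in>Arr D. inv_into (Arr C) (far F) f)\<rparr>"
  have ob1: "fob G y \<in> Obj C" "fob F (fob G y) = y" if "y \<in> Obj D" for y
    using that ob by (auto simp: G_def bij_betw_def inv_into_into f_inv_into_f)
  have ar1: "far G g \<in> Arr C" "far F (far G g) = g" if "g \<in> Arr D" for g
    using that ar by (auto simp: G_def bij_betw_def inv_into_into f_inv_into_f)
  have ob2: "fob G (fob F x) = x" if "x \<in> Obj C" for x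
    using that ob F by (auto simp: G_def bij_betw_def is_functor_Obj)
  have ar2: "far G (far F f) = f" if "f \<in> Arr C" for f
    using that ar F by (auto simp: G_def bij_betw_def is_functor_Arr)
  have dom: "Dom C (far G g) = fob G (Dom D g)" "Cod C (far G g) = fob G (Cod D g)"
    if "g \<in> Arr D" for g
  proof -
    have "Dom D (far F (far G g)) = fob F (Dom C (far G g))"
      "Cod D (far F (far G g)) = fob F (Cod C (far G g))"
      using F ar1(1)[OF that] by (simp_all add: is_functor_def)
    then have "Dom D g = fob F (Dom C (far G g))" "Cod D g = fob F (Cod C (far G g))"
      by (simp_all add: ar1(2)[OF that])
    then show "Dom C (far G g) = fob G (Dom D g)" "Cod C (far G g) = fob G (Cod D g)"
      using that ar1 ob2 C.Dom_Obj C.Cod_Obj by metis+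
  qed
  have "is_functor D C G"
    unfolding is_functor_def
  proof (intro conjI ballI allI impI)
    show "fob G \<in> Obj D \<rightarrow>\<^sub>E Obj C" "far G \<in> Arr D \<rightarrow>\<^sub>E Arr C"
      using ob1 ar1 by (auto simp: G_def)
    fix x assume x: "x \<in> Obj D"
    then have "far F (Ident C (fob G x)) = Ident D x"
      using F ob1 by (simp add: is_functor_Ident)
    then show "far G (Ident D x) = Ident C (fob G x)"
      using ar2[of "Ident C (fob G x)"] C.Ident[of "fob G x"] ob1 x by (simp add: Hom_def)
  next
    fix g f assume gf: "seq D g f"
    then have s: "seq C (far G g) (far G f)"
      using ar1 dom by (simp add: seq_def)
    then have "far F (Comp C (far G g) (far G f)) = Comp D g f"
      using F ar1 gf by (simp add: is_functor_def seq_def)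
    then show "far G (Comp D g f) = Comp C (far G g) (far G f)"
      using ar2[of "Comp C (far G g) (far G f)"] C.Comp[OF s] by (simp add: Hom_def)
  qed (use dom in auto)
  moreover have "fctr_comp (Obj C) (Arr C) G F = fctr_id (Obj C) (Arr C)"
    using ob2 ar2 by (auto intro!: fctr_eqI[of _ "Obj C" _ "Arr C"])
  moreover have "fctr_comp (Obj D) (Arr D) F G = fctr_id (Obj D) (Arr D)"
    using ob1 ar1 by (auto intro!: fctr_eqI[of _ "Obj D" _ "Arr D"])
  ultimately show ?thesis
    unfolding isomorphism_of_categories_def using C D F by blast
qed

section \<open>Categories of structures and slice categories\<close>

lemma structure_category_simps:
  fixes S :: "'s set" and ob :: "'s \<Rightarrow> 'o set" and mor :: "'s \<Rightarrow> 'm set"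
  defines "K H \<equiv> structure_category S ob mor H"
  shows "Obj (K H) = S"
    "(X, F, Y) \<in> Arr (K H) \<longleftrightarrow> X \<in> S \<and> Y \<in> S \<and> H X Y F"
    "X \<in> S \<Longrightarrow> Y \<in> S \<Longrightarrow> H X Y F \<Longrightarrow> Dom (K H) (X, F, Y) = X"
    "X \<in> S \<Longrightarrow> Y \<in> S \<Longrightarrow> H X Y F \<Longrightarrow> Cod (K H) (X, F, Y) = Y"
    "X \<in> S \<Longrightarrow> Ident (K H) X = (X, fctr_id (ob X) (mor X), X)"
    "\<lbrakk>X \<in> S; Y \<in> S; Z \<in> S; H X Y F; H Y Z G\<rbrakk>
      \<Longrightarrow> Comp (K H) (Y, G, Z) (X, F, Y) = (X, fctr_comp (ob X) (mor X) G F, Z)"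
  by (simp_all add: K_def structure_category_def Let_def)

text \<open>
  Extensionality of the functors in \<open>H\<close> is what makes the unit laws hold: composing \<open>F\<close> with an
  identity restricts \<open>F\<close> to \<open>ob X\<close> and \<open>mor X\<close>, which gives \<open>F\<close> back only if \<open>F\<close> is undefined
  elsewhere.
\<close>

lemma category_structure_category:
  fixes S :: "'s set" and ob :: "'s \<Rightarrow> 'o set" and mor :: "'s \<Rightarrow> 'm set"
  assumes H_data: "\<And>X Y F. X \<in> S \<Longrightarrow> Y \<in> S \<Longrightarrow> H X Y F
      \<Longrightarrow> fob F \<in> ob X \<rightarrow>\<^sub>E ob Y \<and> far F \<in> mor X \<rightarrow>\<^sub>E mor Y"
    and H_id: "\<And>X. X \<in> S \<Longrightarrow> H X X (fctr_id (ob X) (mor X))"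
    and H_comp: "\<And>X Y Z F G. \<lbrakk>X \<in> S; Y \<in> S; Z \<in> S; H X Y F; H Y Z G\<rbrakk>
      \<Longrightarrow> H X Z (fctr_comp (ob X) (mor X) G F)"
  shows "category (structure_category S ob mor H)" (is "category ?K")
proof
  note K = structure_category_simps[where S = S and ob = ob and mor = mor and H = H]
  have arrE: "\<exists>X F Y. f = (X, F, Y) \<and> X \<in> S \<and> Y \<in> S \<and> H X Y F" if "f \<in> Arr ?K" for f
    using that K(2) by (cases f) auto
  have seqE: "\<exists>X F Y G Z. f = (X, F, Y) \<and> g = (Y, G, Z) \<and> X \<in> S \<and> Y \<in> S \<and> Z \<in> S
      \<and> H X Y F \<and> H Y Z G" if "seq ?K g f" for f g
    using that arrE[of f] arrE[of g] K(3,4) unfolding seq_def by metis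
  show "Dom ?K \<in> Arr ?K \<rightarrow>\<^sub>E Obj ?K" "Cod ?K \<in> Arr ?K \<rightarrow>\<^sub>E Obj ?K"
    by (auto simp: structure_category_def Let_def)
  show "Ident ?K \<in> extensional (Obj ?K)"
    by (auto simp: structure_category_def Let_def)
  show "Ident ?K X \<in> Hom ?K X X" if "X \<in> Obj ?K" for X
    using that H_id by (simp add: K Hom_def)
  show "Comp ?K g f = undefined" if "\<not> seq ?K g f" for g f
    using that by (auto simp: structure_category_def Let_def seq_def split: prod.splits)
  show "Comp ?K g f \<in> Hom ?K (Dom ?K f) (Cod ?K g)" if "seq ?K g f" for g f
    using seqE[OF that] H_comp by (auto simp: K Hom_def)
  show "Comp ?K f (Ident ?K (Dom ?K f)) = f" "Comp ?K (Ident ?K (Cod ?K f)) f = f"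
    if f: "f \<in> Arr ?K" for f
  proof -
    obtain X F Y where F: "f = (X, F, Y)" "X \<in> S" "Y \<in> S" "H X Y F"
      using arrE[OF f] by blast
    have "fctr_comp (ob X) (mor X) F (fctr_id (ob X) (mor X)) = F"
      "fctr_comp (ob X) (mor X) (fctr_id (ob Y) (mor Y)) F = F"
      using H_data[OF F(2-4)] by (auto simp: PiE_iff intro!: fctr_eqI[of _ "ob X" _ "mor X"])
    then show "Comp ?K f (Ident ?K (Dom ?K f)) = f" "Comp ?K (Ident ?K (Cod ?K f)) f = f"
      using F H_id by (simp_all add: K)
  qed
  show "Comp ?K h (Comp ?K g f) = Comp ?K (Comp ?K h g) f" if hg: "seq ?K h g" and gf: "seq ?K g f"
    for h g f
  proof -
    obtain X F Y G Z where 1: "f = (X, F, Y)" "g = (Y, G, Z)" "X \<in> S" "Y \<in> S" "Z \<in> S"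
        "H X Y F" "H Y Z G"
      using seqE[OF gf] by blast
    obtain H' W where 2: "h = (Z, H', W)" "W \<in> S" "H Z W H'"
      using seqE[OF hg] 1(2) by blast
    have "fctr_comp (ob X) (mor X) H' (fctr_comp (ob X) (mor X) G F)
        = fctr_comp (ob X) (mor X) (fctr_comp (ob Y) (mor Y) H' G) F"
      using H_data[OF 1(3,4,6)] by (auto intro!: fctr_eqI[of _ "ob X" _ "mor X"])
    then show ?thesis
      using 1 2 H_comp by (simp add: K)
  qed
qed

lemma category_Cat: "category (Cat :: (_, ('o, 'm) category \<times> _ \<times> _) category)"
  unfolding Cat_def
proof (rule category_structure_category)
  fix C D :: "('o, 'm) category" and F :: "('o, 'm, 'o, 'm) fctr"
  assume "is_functor C D F"
  then show "fob F \<in> Obj C \<rightarrow>\<^sub>E Obj D \<and> far F \<in> Arr C \<rightarrow>\<^sub>E Arr D"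
    by (simp add: is_functor_def)
qed (auto intro: is_functor_id is_functor_comp)

lemma slice_simps:
  "p \<in> Obj (slice C c) \<longleftrightarrow> p \<in> Arr C \<and> Cod C p = c"
  "(p, f, q) \<in> Arr (slice C c) \<longleftrightarrow> p \<in> Obj (slice C c) \<and> q \<in> Obj (slice C c)
     \<and> f \<in> Hom C (Dom C p) (Dom C q) \<and> Comp C q f = p"
  "(p, f, q) \<in> Arr (slice C c) \<Longrightarrow> Dom (slice C c) (p, f, q) = p"
  "(p, f, q) \<in> Arr (slice C c) \<Longrightarrow> Cod (slice C c) (p, f, q) = q"
  "p \<in> Obj (slice C c) \<Longrightarrow> Ident (slice C c) p = (p, Ident C (Dom C p), p)"
  "(p, f, q) \<in> Arr (slice C c) \<Longrightarrow> (q, g, r) \<in> Arr (slice C c)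
     \<Longrightarrow> Comp (slice C c) (q, g, r) (p, f, q) = (p, Comp C g f, r)"
  by (simp_all add: slice_def Let_def)

lemma slice_Hom_iff:
  "x \<in> Hom (slice C c) p q \<longleftrightarrow> (\<exists>f. x = (p, f, q) \<and> (p, f, q) \<in> Arr (slice C c))"
  by (cases x) (auto simp: Hom_def slice_simps(3,4))

lemma slice_seq:
  assumes "seq (slice C c) y x"
  obtains p f q g r where "x = (p, f, q)" "y = (q, g, r)"
    "(p, f, q) \<in> Arr (slice C c)" "(q, g, r) \<in> Arr (slice C c)"
  using assms by (cases x; cases y) (auto simp: seq_def slice_simps(3,4))

context category
begin

lemma slice_Comp_Arr:
  assumes "(p, f, q) \<in> Arr (slice C c)" "(q, g, r) \<in> Arr (slice C c)"
  shows "(p, Comp C g f, r) \<in> Arr (slice C c)"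
proof -
  have *: "r \<in> Hom C (Dom C r) c" "g \<in> Hom C (Dom C q) (Dom C r)" "f \<in> Hom C (Dom C p) (Dom C q)"
    using assms by (auto simp: slice_simps(1,2) Hom_def)
  have "Comp C r (Comp C g f) = p"
    using assms assoc_Hom[OF *] by (simp add: slice_simps(2))
  then show ?thesis
    using assms Comp_Hom * by (simp add: slice_simps(2))
qed

lemma category_slice: "category (slice C c)" (is "category ?S")
proof
  have arrE: "\<exists>p f q. x = (p, f, q) \<and> (p, f, q) \<in> Arr ?S" if "x \<in> Arr ?S" for x
    using that by (cases x) auto
  show "Dom ?S \<in> Arr ?S \<rightarrow>\<^sub>E Obj ?S" "Cod ?S \<in> Arr ?S \<rightarrow>\<^sub>E Obj ?S" "Ident ?S \<in> extensional (Obj ?S)"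
    by (auto simp: slice_def Let_def)
  have ident: "(p, Ident C (Dom C p), p) \<in> Arr ?S" if "p \<in> Obj ?S" for p
    using that Ident Dom_Obj Comp_Ident by (simp add: slice_simps(1,2))
  then show "Ident ?S p \<in> Hom ?S p p" if "p \<in> Obj ?S" for p
    using that by (simp add: slice_simps(5) slice_Hom_iff)
  show "Comp ?S y x = undefined" if "\<not> seq ?S y x" for y x
    using that by (auto simp: slice_def Let_def seq_def split: prod.splits)
  show "Comp ?S y x \<in> Hom ?S (Dom ?S x) (Cod ?S y)" if "seq ?S y x" for y x
    using that
  proof (rule slice_seq)
    fix p f q g r
    assume *: "x = (p, f, q)" "y = (q, g, r)" "(p, f, q) \<in> Arr ?S" "(q, g, r) \<in> Arr ?S"
    show ?thesis
      unfolding *(1,2) slice_simps(6)[OF *(3,4)] slice_simps(3)[OF *(3)] slice_simps(4)[OF *(4)]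
      using slice_Comp_Arr[OF *(3,4)] by (simp add: slice_Hom_iff)
  qed
  show "Comp ?S x (Ident ?S (Dom ?S x)) = x" "Comp ?S (Ident ?S (Cod ?S x)) x = x"
    if "x \<in> Arr ?S" for x
  proof -
    obtain p f q where x: "x = (p, f, q)" and a: "(p, f, q) \<in> Arr ?S"
      using arrE[OF \<open>x \<in> Arr ?S\<close>] by blast
    have pq: "p \<in> Obj ?S" "q \<in> Obj ?S" "f \<in> Hom C (Dom C p) (Dom C q)"
      using a by (simp_all add: slice_simps(2))
    show "Comp ?S x (Ident ?S (Dom ?S x)) = x"
      unfolding x slice_simps(3)[OF a] slice_simps(5)[OF pq(1)] slice_simps(6)[OF ident[OF pq(1)] a]
      by (simp add: Comp_Ident_Hom[OF pq(3)])
    show "Comp ?S (Ident ?S (Cod ?S x)) x = x"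
      unfolding x slice_simps(4)[OF a] slice_simps(5)[OF pq(2)] slice_simps(6)[OF a ident[OF pq(2)]]
      by (simp add: Ident_Comp_Hom[OF pq(3)])
  qed
  show "Comp ?S z (Comp ?S y x) = Comp ?S (Comp ?S z y) x"
    if zy: "seq ?S z y" and yx: "seq ?S y x" for z y x
  proof -
    obtain p f q g r where 1: "x = (p, f, q)" "y = (q, g, r)"
      and f: "(p, f, q) \<in> Arr ?S" and g: "(q, g, r) \<in> Arr ?S"
      using yx by (rule slice_seq)
    obtain h s where 2: "z = (r, h, s)" and h: "(r, h, s) \<in> Arr ?S"
      using zy 1(2) by (auto elim: slice_seq)
    have "Comp C (Comp C h g) f = Comp C h (Comp C g f)"
      using f g h by (auto simp: slice_simps(2) intro: assoc_Hom)
    then show ?thesis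
      using f g h slice_Comp_Arr[OF f g] slice_Comp_Arr[OF g h]
      by (simp add: 1 2 slice_simps(6))
  qed
qed

end

section \<open>Model structures on slice categories and along isomorphisms\<close>

lemma slice_classes_simps:
  "(p, f, q) \<in> weq (slice_classes C c M) \<longleftrightarrow> (p, f, q) \<in> Arr (slice C c) \<and> f \<in> weq M"
  "(p, f, q) \<in> cof (slice_classes C c M) \<longleftrightarrow> (p, f, q) \<in> Arr (slice C c) \<and> f \<in> cof M"
  "(p, f, q) \<in> fib (slice_classes C c M) \<longleftrightarrow> (p, f, q) \<in> Arr (slice C c) \<and> f \<in> fib M"
  by (simp_all add: slice_classes_def)

context category
begin

text \<open>
  A diagonal filler \<open>h\<close> of the underlying square is automatically a morphism over \<open>c\<close>, since the
  structure map of its target is \<open>s \<circ> x\<close> and \<open>x \<circ> h\<close>, the bottom of the square, is over \<open>c\<close>.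
\<close>

lemma has_lifting_slice:
  assumes i: "(p, i, q) \<in> Arr (slice C c)" and x: "(r, x, s) \<in> Arr (slice C c)"
    and lift: "has_lifting C i x"
  shows "has_lifting (slice C c) (p, i, q) (r, x, s)"
  unfolding has_lifting_def slice_simps(3)[OF i] slice_simps(4)[OF i]
    slice_simps(3)[OF x] slice_simps(4)[OF x]
proof (intro ballI impI)
  fix u' v' assume uv: "u' \<in> Hom (slice C c) p r" "v' \<in> Hom (slice C c) q s"
    and eq: "Comp (slice C c) (r, x, s) u' = Comp (slice C c) v' (p, i, q)"
  obtain u v where u': "u' = (p, u, r)" and u: "(p, u, r) \<in> Arr (slice C c)"
    and v': "v' = (q, v, s)" and v: "(q, v, s) \<in> Arr (slice C c)"
    using uv by (auto simp: slice_Hom_iff)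
  have "Comp C x u = Comp C v i"
    using eq by (simp add: u' v' slice_simps(6)[OF u x] slice_simps(6)[OF i v])
  moreover have "u \<in> Hom C (Dom C i) (Dom C x)" "v \<in> Hom C (Cod C i) (Cod C x)"
    using i x u v by (auto simp: slice_simps(2) Hom_def)
  ultimately obtain h where h: "h \<in> Hom C (Cod C i) (Dom C x)" "Comp C h i = u" "Comp C x h = v"
    using lift by (auto simp: has_lifting_def)
  have s: "s \<in> Hom C (Dom C s) c" "x \<in> Hom C (Dom C r) (Dom C s)" "h \<in> Hom C (Dom C q) (Dom C r)"
    using h(1) i x by (auto simp: slice_simps(1,2) Hom_def)
  have "Comp C r h = q"
    using assoc_Hom[OF s] x v h(3) by (simp add: slice_simps(2))
  then have "(q, h, r) \<in> Arr (slice C c)"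
    using i x s by (simp add: slice_simps(2))
  then show "\<exists>h'\<in>Hom (slice C c) q r. Comp (slice C c) h' (p, i, q) = u'
      \<and> Comp (slice C c) (r, x, s) h' = v'"
    using h i x by (intro bexI[of _ "(q, h, r)"]) (simp_all add: slice_simps(6) slice_Hom_iff u' v')
qed

lemma retract_of_slice:
  assumes f: "(p, f, q) \<in> Arr (slice C c)" and g: "(r, g, s) \<in> Arr (slice C c)"
    and ret: "retract_of (slice C c) (p, f, q) (r, g, s)"
  shows "retract_of C f g"
proof -
  obtain i' r' j' s' where
    hom: "i' \<in> Hom (slice C c) p r" "r' \<in> Hom (slice C c) r p"
      "j' \<in> Hom (slice C c) q s" "s' \<in> Hom (slice C c) s q"
    and eq: "Comp (slice C c) r' i' = Ident (slice C c) p"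
      "Comp (slice C c) s' j' = Ident (slice C c) q"
      "Comp (slice C c) (r, g, s) i' = Comp (slice C c) j' (p, f, q)"
      "Comp (slice C c) (p, f, q) r' = Comp (slice C c) s' (r, g, s)"
    using ret unfolding retract_of_def slice_simps(3)[OF f] slice_simps(4)[OF f]
      slice_simps(3)[OF g] slice_simps(4)[OF g] by blast
  obtain i0 r0 j0 s0 where
    *: "i' = (p, i0, r)" "r' = (r, r0, p)" "j' = (q, j0, s)" "s' = (s, s0, q)"
    and **: "(p, i0, r) \<in> Arr (slice C c)" "(r, r0, p) \<in> Arr (slice C c)"
      "(q, j0, s) \<in> Arr (slice C c)" "(s, s0, q) \<in> Arr (slice C c)"
    using hom by (auto simp: slice_Hom_iff)
  have pq: "p \<in> Obj (slice C c)" "q \<in> Obj (slice C c)"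
    using f by (simp_all add: slice_simps(2))
  have dc: "Dom C f = Dom C p" "Cod C f = Dom C q" "Dom C g = Dom C r" "Cod C g = Dom C s"
    using f g by (simp_all add: slice_simps(2) Hom_def)
  have hom0: "i0 \<in> Hom C (Dom C p) (Dom C r)" "r0 \<in> Hom C (Dom C r) (Dom C p)"
      "j0 \<in> Hom C (Dom C q) (Dom C s)" "s0 \<in> Hom C (Dom C s) (Dom C q)"
    using ** by (simp_all add: slice_simps(2))
  have "Comp C r0 i0 = Ident C (Dom C p)" "Comp C s0 j0 = Ident C (Dom C q)"
    "Comp C g i0 = Comp C j0 f" "Comp C f r0 = Comp C s0 g"
    using eq ** f g by (simp_all add: * slice_simps(6) slice_simps(5)[OF pq(1)] slice_simps(5)[OF pq(2)])
  then show ?thesis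
    unfolding retract_of_def dc using hom0 by blast
qed

text \<open>
  A factorization of the underlying morphism through \<open>t\<close> lifts to the slice: \<open>t\<close> becomes an object
  over \<open>c\<close> by way of the structure map of the target.
\<close>

lemma slice_factor:
  assumes f: "(p, f, q) \<in> Arr (slice C c)" and gi: "seq C g i" "f = Comp C g i"
  defines "t \<equiv> Comp C q g"
  shows "(p, i, t) \<in> Arr (slice C c)" "(t, g, q) \<in> Arr (slice C c)"
    "Comp (slice C c) (t, g, q) (p, i, t) = (p, f, q)"
proof -
  have *: "Dom C i = Dom C p" "Cod C g = Dom C q"
    using f gi Comp[OF gi(1)] by (auto simp: slice_simps(2) Hom_def)
  then have q: "q \<in> Hom C (Dom C q) c" and g: "g \<in> Hom C (Cod C i) (Dom C q)"
    and i: "i \<in> Hom C (Dom C p) (Cod C i)"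
    using f gi by (auto simp: slice_simps(1,2) Hom_def seq_def)
  have t: "t \<in> Hom C (Cod C i) c"
    unfolding t_def using q g by (rule Comp_Hom)
  have "Comp C t i = p"
    using assoc_Hom[OF q g i] f gi by (simp add: t_def slice_simps(2))
  then show 1: "(p, i, t) \<in> Arr (slice C c)"
    using f t i by (simp add: slice_simps(1,2) Hom_def)
  show 2: "(t, g, q) \<in> Arr (slice C c)"
    using f t g by (simp add: slice_simps(1,2) Hom_def t_def)
  show "Comp (slice C c) (t, g, q) (p, i, t) = (p, f, q)"
    using gi by (simp add: slice_simps(6)[OF 1 2])
qed

end

text \<open>
  Two-out-of-three and closure under retracts concern underlying morphisms only; for lifting and
  factorization the objects and arrows found in \<open>C\<close> are moved to the slice by
  \<open>has_lifting_slice\<close> and \<open>slice_factor\<close>.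
\<close>

theorem (in model_structure) model_structure_slice:
  "model_structure (slice C c) (slice_classes C c M)" (is "model_structure ?S ?N")
proof (rule model_structure.intro[OF category_slice], unfold_locales)
  show sub: "weq ?N \<subseteq> Arr ?S" "cof ?N \<subseteq> Arr ?S" "fib ?N \<subseteq> Arr ?S"
    by (auto simp: slice_classes_def)
  show "x \<in> weq ?N \<Longrightarrow> y \<in> weq ?N \<Longrightarrow> Comp ?S y x \<in> weq ?N"
    "x \<in> weq ?N \<Longrightarrow> Comp ?S y x \<in> weq ?N \<Longrightarrow> y \<in> weq ?N"
    "y \<in> weq ?N \<Longrightarrow> Comp ?S y x \<in> weq ?N \<Longrightarrow> x \<in> weq ?N" if "seq ?S y x" for y x
  proof -
    obtain p f q g r where xy: "x = (p, f, q)" "y = (q, g, r)"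
      and f: "(p, f, q) \<in> Arr ?S" and g: "(q, g, r) \<in> Arr ?S"
      using \<open>seq ?S y x\<close> by (rule slice_seq)
    have gf: "seq C g f"
      using f g by (simp add: slice_simps(2) Hom_def seq_def)
    show "x \<in> weq ?N \<Longrightarrow> y \<in> weq ?N \<Longrightarrow> Comp ?S y x \<in> weq ?N"
      "x \<in> weq ?N \<Longrightarrow> Comp ?S y x \<in> weq ?N \<Longrightarrow> y \<in> weq ?N"
      "y \<in> weq ?N \<Longrightarrow> Comp ?S y x \<in> weq ?N \<Longrightarrow> x \<in> weq ?N"
      unfolding xy slice_simps(6)[OF f g] slice_classes_simps
      using two_of_three[OF gf] slice_Comp_Arr[OF f g] f g by blast+
  qed
  show "retract_of ?S x y \<Longrightarrow> y \<in> weq ?N \<Longrightarrow> x \<in> weq ?N"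
    "retract_of ?S x y \<Longrightarrow> y \<in> cof ?N \<Longrightarrow> x \<in> cof ?N"
    "retract_of ?S x y \<Longrightarrow> y \<in> fib ?N \<Longrightarrow> x \<in> fib ?N" if x: "x \<in> Arr ?S" for x y
  proof -
    obtain p f q r g s where *: "x = (p, f, q)" "y = (r, g, s)"
      by (cases x, cases y)
    have f: "f \<in> Arr C"
      using x by (simp add: * slice_simps(2) Hom_def)
    show "retract_of ?S x y \<Longrightarrow> y \<in> weq ?N \<Longrightarrow> x \<in> weq ?N"
      "retract_of ?S x y \<Longrightarrow> y \<in> cof ?N \<Longrightarrow> x \<in> cof ?N"
      "retract_of ?S x y \<Longrightarrow> y \<in> fib ?N \<Longrightarrow> x \<in> fib ?N"
      using x retracts[OF f, of g] retract_of_slice[of p f q c r g s]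
      by (simp_all add: * slice_classes_simps)
  qed
  show "has_lifting ?S x y" if "x \<in> cof ?N" "y \<in> fib ?N" "x \<in> weq ?N \<or> y \<in> weq ?N" for x y
    using that lifting has_lifting_slice
    by (cases x; cases y) (auto simp: slice_classes_simps)
  show "\<exists>y z. seq ?S y z \<and> x = Comp ?S y z \<and> z \<in> cof ?N \<inter> weq ?N \<and> y \<in> fib ?N"
    "\<exists>y z. seq ?S y z \<and> x = Comp ?S y z \<and> z \<in> cof ?N \<and> y \<in> fib ?N \<inter> weq ?N" if x: "x \<in> Arr ?S" for x
  proof -
    obtain p f q where xe: "x = (p, f, q)"
      by (cases x)
    have f: "f \<in> Arr C"
      using x by (simp add: xe slice_simps(2) Hom_def)
    note fac = slice_factor[OF x[unfolded xe]]
    have seq: "seq ?S (t, g, q) (p, i, t)"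
      if "(p, i, t) \<in> Arr ?S" "(t, g, q) \<in> Arr ?S" for i g t
      using that by (simp add: seq_def slice_simps(3,4))
    obtain g i where 1: "seq C g i" "f = Comp C g i" "i \<in> cof M \<inter> weq M" "g \<in> fib M"
      using factorization(1)[OF f] by blast
    show "\<exists>y z. seq ?S y z \<and> x = Comp ?S y z \<and> z \<in> cof ?N \<inter> weq ?N \<and> y \<in> fib ?N"
      using fac[OF 1(1,2)] seq[OF fac(1,2)[OF 1(1,2)]] 1(3,4) unfolding xe
      by (intro exI[of _ "(Comp C q g, g, q)"] exI[of _ "(p, i, Comp C q g)"])
        (simp add: slice_classes_simps)
    obtain g i where 2: "seq C g i" "f = Comp C g i" "i \<in> cof M" "g \<in> fib M \<inter> weq M"
      using factorization(2)[OF f] by blast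
    show "\<exists>y z. seq ?S y z \<and> x = Comp ?S y z \<and> z \<in> cof ?N \<and> y \<in> fib ?N \<inter> weq ?N"
      using fac[OF 2(1,2)] seq[OF fac(1,2)[OF 2(1,2)]] 2(3,4) unfolding xe
      by (intro exI[of _ "(Comp C q g, g, q)"] exI[of _ "(p, i, Comp C q g)"])
        (simp add: slice_classes_simps)
  qed
qed

lemma is_functor_retract_of:
  assumes C: "category C" and F: "is_functor C D F" and fg: "f \<in> Arr C" "g \<in> Arr C"
    and ret: "retract_of C f g"
  shows "retract_of D (far F f) (far F g)"
proof -
  interpret category C by fact
  obtain i r j s where
    h: "i \<in> Hom C (Dom C f) (Dom C g)" "r \<in> Hom C (Dom C g) (Dom C f)"
      "j \<in> Hom C (Cod C f) (Cod C g)" "s \<in> Hom C (Cod C g) (Cod C f)"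
    and e: "Comp C r i = Ident C (Dom C f)" "Comp C s j = Ident C (Cod C f)"
        "Comp C g i = Comp C j f" "Comp C f r = Comp C s g"
    using ret by (auto simp: retract_of_def)
  have f: "f \<in> Hom C (Dom C f) (Cod C f)" "g \<in> Hom C (Dom C g) (Cod C g)"
    using fg by (simp_all add: Hom_def)
  have dc: "Dom D (far F f) = fob F (Dom C f)" "Cod D (far F f) = fob F (Cod C f)"
    "Dom D (far F g) = fob F (Dom C g)" "Cod D (far F g) = fob F (Cod C g)"
    using fg F by (simp_all add: is_functor_def)
  note Fc = is_functor_Comp[OF F]
  have "Comp D (far F r) (far F i) = Ident D (fob F (Dom C f))"
    "Comp D (far F s) (far F j) = Ident D (fob F (Cod C f))"
    "Comp D (far F g) (far F i) = Comp D (far F j) (far F f)"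
    "Comp D (far F f) (far F r) = Comp D (far F s) (far F g)"
    using Fc[OF h(2,1)] Fc[OF h(4,3)] Fc[OF f(2) h(1)] Fc[OF h(3) f(1)] Fc[OF f(1) h(2)]
      Fc[OF h(4) f(2)] e is_functor_Ident[OF F] Dom_Obj Cod_Obj fg by simp_all
  then show ?thesis
    unfolding retract_of_def dc using h[THEN is_functor_Hom[OF F]] by blast
qed

text \<open>
  A morphism lies in the image of a class under \<open>F\<close> if and only if the inverse functor maps it into
  the class. Thus every axiom is checked by applying the inverse functor, using the axiom in \<open>C\<close>, and
  transporting what it provides back by \<open>F\<close>.
\<close>

theorem model_structure_image:
  assumes iso: "isomorphism_of_categories C D F" and M: "model_structure C M"
  shows "model_structure D (image_classes F M)" (is "model_structure D ?N")
proof -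
  interpret M: model_structure C M by fact
  have C: "category C" and D: "category D" and F: "is_functor C D F"
    using iso by (simp_all add: isomorphism_of_categories_def)
  interpret D: category D by fact
  obtain G where G: "is_functor D C G"
    and GF: "fctr_comp (Obj C) (Arr C) G F = fctr_id (Obj C) (Arr C)"
    and FG: "fctr_comp (Obj D) (Arr D) F G = fctr_id (Obj D) (Arr D)"
    using iso by (auto simp: isomorphism_of_categories_def)
  have GFo: "fob G (fob F x) = x" if "x \<in> Obj C" for x
    using arg_cong[OF GF, of "\<lambda>H. fob H x"] that by simp
  have GFa: "far G (far F f) = f" if "f \<in> Arr C" for f
    using arg_cong[OF GF, of "\<lambda>H. far H f"] that by simp
  have FGo: "fob F (fob G x) = x" if "x \<in> Obj D" for x
    using arg_cong[OF FG, of "\<lambda>H. fob H x"] that by simp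
  have FGa: "far F (far G f) = f" if "f \<in> Arr D" for f
    using arg_cong[OF FG, of "\<lambda>H. far H f"] that by simp
  have image: "f \<in> far F ` A \<longleftrightarrow> far G f \<in> A" if "f \<in> Arr D" "A \<subseteq> Arr C" for f A
  proof
    show "far G f \<in> A" if "f \<in> far F ` A"
      using that \<open>A \<subseteq> Arr C\<close> GFa by auto
    show "f \<in> far F ` A" if "far G f \<in> A"
      using imageI[OF that, of "far F"] FGa[OF \<open>f \<in> Arr D\<close>] by simp
  qed
  have N: "f \<in> weq ?N \<longleftrightarrow> far G f \<in> weq M" "f \<in> cof ?N \<longleftrightarrow> far G f \<in> cof M"
    "f \<in> fib ?N \<longleftrightarrow> far G f \<in> fib M" if "f \<in> Arr D" for f
    using that image M.classes by (simp_all add: image_classes_def)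
  have N': "far F f \<in> weq ?N \<longleftrightarrow> f \<in> weq M" "far F f \<in> cof ?N \<longleftrightarrow> f \<in> cof M"
    "far F f \<in> fib ?N \<longleftrightarrow> f \<in> fib M" if "f \<in> Arr C" for f
    using that N[of "far F f"] F GFa by (simp_all add: is_functor_Arr)
  have seqG: "seq C (far G g) (far G f)" "far G (Comp D g f) = Comp C (far G g) (far G f)"
    "f \<in> Arr D" "g \<in> Arr D" "Comp D g f \<in> Arr D" if "seq D g f" for g f
    using that G D.Comp[OF that] by (auto simp: is_functor_def seq_def Hom_def)
  have seqF: "seq D (far F g) (far F f)" "Comp D (far F g) (far F f) = far F (Comp C g f)"
    if "seq C g f" for g f
    using that F by (auto simp: is_functor_def seq_def)
  show ?thesis
  proof (rule model_structure.intro[OF D], unfold_locales)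
    show sub: "weq ?N \<subseteq> Arr D" "cof ?N \<subseteq> Arr D" "fib ?N \<subseteq> Arr D"
      using M.classes is_functor_Arr[OF F] by (auto simp: image_classes_def)
    show "f \<in> weq ?N \<Longrightarrow> g \<in> weq ?N \<Longrightarrow> Comp D g f \<in> weq ?N"
      "f \<in> weq ?N \<Longrightarrow> Comp D g f \<in> weq ?N \<Longrightarrow> g \<in> weq ?N"
      "g \<in> weq ?N \<Longrightarrow> Comp D g f \<in> weq ?N \<Longrightarrow> f \<in> weq ?N" if "seq D g f" for g f
      using seqG[OF that] M.two_of_three[OF seqG(1)[OF that]] by (simp_all add: N)
    show "retract_of D f g \<Longrightarrow> g \<in> weq ?N \<Longrightarrow> f \<in> weq ?N"
      "retract_of D f g \<Longrightarrow> g \<in> cof ?N \<Longrightarrow> f \<in> cof ?N"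
      "retract_of D f g \<Longrightarrow> g \<in> fib ?N \<Longrightarrow> f \<in> fib ?N" if f: "f \<in> Arr D" for f g
      using f sub is_functor_retract_of[OF D G f, of g] is_functor_Arr[OF G f]
        M.retracts[of "far G f" "far G g"] N by (meson subsetD)+
    show "has_lifting D i p" if "i \<in> cof ?N" "p \<in> fib ?N" "i \<in> weq ?N \<or> p \<in> weq ?N" for i p
      unfolding has_lifting_def
    proof (intro ballI impI)
      fix u v assume u: "u \<in> Hom D (Dom D i) (Dom D p)" and v: "v \<in> Hom D (Cod D i) (Cod D p)"
        and eq: "Comp D p u = Comp D v i"
      have ip: "i \<in> Arr D" "p \<in> Arr D"
        using that sub by auto
      then have dc: "Dom C (far G i) = fob G (Dom D i)" "Cod C (far G i) = fob G (Cod D i)"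
        "Dom C (far G p) = fob G (Dom D p)" "Cod C (far G p) = fob G (Cod D p)"
        using G by (simp_all add: is_functor_def)
      have i: "i \<in> Hom D (Dom D i) (Cod D i)" and p: "p \<in> Hom D (Dom D p) (Cod D p)"
        using ip by (simp_all add: Hom_def)
      have "has_lifting C (far G i) (far G p)"
        using that ip by (intro M.lifting) (auto simp: N)
      moreover have "Comp C (far G p) (far G u) = Comp C (far G v) (far G i)"
        using is_functor_Comp[OF G p u] is_functor_Comp[OF G v i] eq by simp
      moreover note is_functor_Hom[OF G u] is_functor_Hom[OF G v]
      ultimately obtain h where h: "h \<in> Hom C (fob G (Cod D i)) (fob G (Dom D p))"
        "Comp C h (far G i) = far G u" "Comp C (far G p) h = far G v"
        unfolding has_lifting_def dc by blast
      have "far F h \<in> Hom D (Cod D i) (Dom D p)"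
        using is_functor_Hom[OF F h(1)] ip D.Dom_Obj D.Cod_Obj by (simp add: FGo)
      moreover have "Comp D (far F h) i = u"
        using is_functor_Comp[OF F h(1) is_functor_Hom[OF G i]] h(2) u ip
        by (simp add: FGa HomD(1))
      moreover have "Comp D p (far F h) = v"
        using is_functor_Comp[OF F is_functor_Hom[OF G p] h(1)] h(3) v ip
        by (simp add: FGa HomD(1))
      ultimately show "\<exists>h\<in>Hom D (Cod D i) (Dom D p). Comp D h i = u \<and> Comp D p h = v"
        by blast
    qed
    show "\<exists>p i. seq D p i \<and> f = Comp D p i \<and> i \<in> cof ?N \<inter> weq ?N \<and> p \<in> fib ?N"
      "\<exists>p i. seq D p i \<and> f = Comp D p i \<and> i \<in> cof ?N \<and> p \<in> fib ?N \<inter> weq ?N" if f: "f \<in> Arr D" for f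
    proof -
      note Gf = is_functor_Arr[OF G f]
      obtain p i where 1: "seq C p i" "far G f = Comp C p i" "i \<in> cof M \<inter> weq M" "p \<in> fib M"
        using M.factorization(1)[OF Gf] by blast
      show "\<exists>p i. seq D p i \<and> f = Comp D p i \<and> i \<in> cof ?N \<inter> weq ?N \<and> p \<in> fib ?N"
        using 1 seqF[OF 1(1)] FGa[OF f]
        by (intro exI[of _ "far F p"] exI[of _ "far F i"]) (auto simp: N' seq_def)
      obtain p i where 2: "seq C p i" "far G f = Comp C p i" "i \<in> cof M" "p \<in> fib M \<inter> weq M"
        using M.factorization(2)[OF Gf] by blast
      show "\<exists>p i. seq D p i \<and> f = Comp D p i \<and> i \<in> cof ?N \<and> p \<in> fib ?N \<inter> weq ?N"
        using 2 seqF[OF 2(1)] FGa[OF f]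
        by (intro exI[of _ "far F p"] exI[of _ "far F i"]) (auto simp: N' seq_def)
    qed
  qed
qed

section \<open>Equivalences of categories\<close>

definition fully_faithful ::
    "('o, 'm) category \<Rightarrow> ('p, 'n) category \<Rightarrow> ('o, 'm, 'p, 'n) fctr \<Rightarrow> bool" where
  "fully_faithful C D F \<longleftrightarrow>
     (\<forall>x\<in>Obj C. \<forall>y\<in>Obj C. bij_betw (far F) (Hom C x y) (Hom D (fob F x) (fob F y)))"

lemma fully_faithfulD:
  assumes "fully_faithful C D F" "x \<in> Obj C" "y \<in> Obj C"
  shows "f \<in> Hom C x y \<Longrightarrow> g \<in> Hom C x y \<Longrightarrow> far F f = far F g \<Longrightarrow> f = g"
    "h \<in> Hom D (fob F x) (fob F y) \<Longrightarrow> \<exists>f\<in>Hom C x y. far F f = h"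
proof -
  have bij: "bij_betw (far F) (Hom C x y) (Hom D (fob F x) (fob F y))"
    using assms by (simp add: fully_faithful_def)
  show "f \<in> Hom C x y \<Longrightarrow> g \<in> Hom C x y \<Longrightarrow> far F f = far F g \<Longrightarrow> f = g"
    using bij_betw_imp_inj_on[OF bij] by (simp add: inj_on_eq_iff)
  show "h \<in> Hom D (fob F x) (fob F y) \<Longrightarrow> \<exists>f\<in>Hom C x y. far F f = h"
    unfolding bij_betw_imp_surj_on[OF bij, symmetric] by auto
qed

text \<open>
  Naturality of \<open>\<eta>\<close> expresses \<open>f\<close> by \<open>G (F f)\<close>, so \<open>F\<close> is faithful, and likewise \<open>G\<close> is faithful by
  naturality of \<open>\<epsilon>\<close>. The candidate for a preimage of \<open>g\<close> is \<open>(\<eta> y)\<inverse> \<circ> G g \<circ> \<eta> x\<close>: its image under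
  \<open>G F\<close> is \<open>G g\<close>, and \<open>G\<close> is faithful.
\<close>

lemma equivalence_imp_fully_faithful:
  assumes C: "category C" and D: "category D" and F: "is_functor C D F"
    and "equivalence_of_categories C D F"
  shows "essentially_surjective C D F \<and> fully_faithful C D F"
proof -
  interpret C: category C by fact
  interpret D: category D by fact
  obtain G \<eta> \<epsilon> where G: "is_functor D C G"
    and \<eta>': "natural_isomorphism C C (fctr_id (Obj C) (Arr C)) (fctr_comp (Obj C) (Arr C) G F) \<eta>"
    and \<epsilon>': "natural_isomorphism D D (fctr_comp (Obj D) (Arr D) F G) (fctr_id (Obj D) (Arr D)) \<epsilon>"
    using assms(4) by (auto simp: equivalence_of_categories_def)
  have \<eta>: "\<eta> x \<in> Hom C x (fob G (fob F x))" "iso C (\<eta> x)" if "x \<in> Obj C" for x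
    using \<eta>' that by (auto simp: natural_isomorphism_def)
  have \<eta>_nat: "Comp C (far G (far F f)) (\<eta> (Dom C f)) = Comp C (\<eta> (Cod C f)) f"
    if "f \<in> Arr C" for f
    using \<eta>' that by (auto simp: natural_isomorphism_def)
  have \<epsilon>: "\<epsilon> x \<in> Hom D (fob F (fob G x)) x" "iso D (\<epsilon> x)" if "x \<in> Obj D" for x
    using \<epsilon>' that by (auto simp: natural_isomorphism_def)
  have \<epsilon>_nat: "Comp D f (\<epsilon> (Dom D f)) = Comp D (\<epsilon> (Cod D f)) (far F (far G f))"
    if "f \<in> Arr D" for f
    using \<epsilon>' that by (auto simp: natural_isomorphism_def)
  have F_inj: "f = g" if f: "f \<in> Hom C x y" and g: "g \<in> Hom C x y" and "far F f = far F g"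
    for f g x y
  proof (rule C.iso_cancel_left)
    note y = C.Hom_Obj(2)[OF f]
    show "iso C (\<eta> y)" "\<eta> y \<in> Hom C y (fob G (fob F y))"
      using \<eta>[OF y] by blast+
    show "Comp C (\<eta> y) f = Comp C (\<eta> y) g"
      using \<eta>_nat[OF HomD(1)[OF f]] \<eta>_nat[OF HomD(1)[OF g]] that(3)
      by (simp add: HomD(2,3)[OF f] HomD(2,3)[OF g])
  qed (rule f g)+
  have G_inj: "f = g" if f: "f \<in> Hom D x y" and g: "g \<in> Hom D x y" and "far G f = far G g"
    for f g x y
  proof (rule D.iso_cancel_right)
    note x = D.Hom_Obj(1)[OF f]
    show "iso D (\<epsilon> x)" "\<epsilon> x \<in> Hom D (fob F (fob G x)) x"
      using \<epsilon>[OF x] by blast+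
    show "Comp D f (\<epsilon> x) = Comp D g (\<epsilon> x)"
      using \<epsilon>_nat[OF HomD(1)[OF f]] \<epsilon>_nat[OF HomD(1)[OF g]] that(3)
      by (simp add: HomD(2,3)[OF f] HomD(2,3)[OF g])
  qed (rule f g)+
  have full: "\<exists>f\<in>Hom C x y. far F f = g"
    if x: "x \<in> Obj C" and y: "y \<in> Obj C" and g: "g \<in> Hom D (fob F x) (fob F y)" for x y g
  proof -
    obtain k where k: "k \<in> Hom C (fob G (fob F y)) y" "Comp C (\<eta> y) k = Ident C (fob G (fob F y))"
      using \<eta>[OF y] C.iso_Hom_iff by blast
    note Gg = is_functor_Hom[OF G g]
    define m where "m = Comp C (far G g) (\<eta> x)"
    have m: "m \<in> Hom C x (fob G (fob F y))"
      unfolding m_def using Gg \<eta>[OF x] by (auto intro: C.Comp_Hom)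
    define f where "f = Comp C k m"
    have f: "f \<in> Hom C x y"
      unfolding f_def using k m by (auto intro: C.Comp_Hom)
    note GFf = is_functor_Hom[OF G is_functor_Hom[OF F f]]
    have "Comp C (far G (far F f)) (\<eta> x) = Comp C (\<eta> y) f"
      using \<eta>_nat[OF HomD(1)[OF f]] f by (simp add: HomD)
    also have "\<dots> = Comp C (far G g) (\<eta> x)"
      unfolding f_def using C.assoc_Hom[OF \<eta>(1)[OF y] k(1) m] C.Ident_Comp_Hom[OF m] k(2)
      by (simp add: m_def)
    finally have "far G (far F f) = far G g"
      using \<eta>[OF x] GFf Gg by (auto intro: C.iso_cancel_right)
    then have "far F f = g"
      using G_inj is_functor_Hom[OF F f] g by blast
    then show ?thesis
      using f by blast
  qed
  have "fully_faithful C D F"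
    unfolding fully_faithful_def bij_betw_def inj_on_def
    using F_inj full is_functor_Hom[OF F] by blast
  moreover have "essentially_surjective C D F"
    unfolding essentially_surjective_def using \<epsilon> G is_functor_Obj by metis
  ultimately show ?thesis by blast
qed

lemma fully_faithful_reflects_iso:
  assumes C: "category C" and F: "is_functor C D F" and ff: "fully_faithful C D F"
    and D: "category D" and f: "f \<in> Hom C x y" and iso: "iso D (far F f)"
  shows "iso C f"
proof -
  interpret C: category C by fact
  interpret D: category D by fact
  note xy = C.Hom_Obj[OF f]
  obtain g' where g': "g' \<in> Hom D (fob F y) (fob F x)"
    "Comp D g' (far F f) = Ident D (fob F x)" "Comp D (far F f) g' = Ident D (fob F y)"
    using D.iso_Hom_iff[OF is_functor_Hom[OF F f]] iso by blast
  obtain g where g: "g \<in> Hom C y x" "far F g = g'"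
    using fully_faithfulD(2)[OF ff xy(2,1) g'(1)] by blast
  have "far F (Comp C g f) = far F (Ident C x)"
    using is_functor_Comp[OF F g(1) f] is_functor_Ident[OF F xy(1)] g' g by simp
  then have 1: "Comp C g f = Ident C x"
    by (rule fully_faithfulD(1)[OF ff xy(1,1) C.Comp_Hom[OF g(1) f] C.Ident[OF xy(1)]])
  have "far F (Comp C f g) = far F (Ident C y)"
    using is_functor_Comp[OF F f g(1)] is_functor_Ident[OF F xy(2)] g' g by simp
  then have "Comp C f g = Ident C y"
    by (rule fully_faithfulD(1)[OF ff xy(2,2) C.Comp_Hom[OF f g(1)] C.Ident[OF xy(2)]])
  then show ?thesis
    using 1 g f C.iso_Hom_iff by blast
qed

text \<open>
  Choose for every \<open>d\<close> an object \<open>c d\<close> with an isomorphism \<open>\<epsilon> d : F (c d) \<rightarrow> d\<close>. An arrow \<open>f\<close> into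
  \<open>c d\<close> is determined by \<open>\<epsilon> d \<circ> F f\<close>, and every arrow from an object \<open>F x\<close> to \<open>d\<close> is of this form. So
  the inverse functor, the unit and all equations between arrows into \<open>c d\<close> can be specified and
  checked after applying \<open>\<epsilon> d \<circ> F\<close>.
\<close>

lemma fully_faithful_imp_equivalence:
  assumes C: "category C" and D: "category D" and F: "is_functor C D F"
    and es: "essentially_surjective C D F" and ff: "fully_faithful C D F"
  shows "equivalence_of_categories C D F"
proof -
  interpret C: category C by fact
  interpret D: category D by fact
  obtain c \<epsilon> where c: "\<And>d. d \<in> Obj D \<Longrightarrow> c d \<in> Obj C"
    and \<epsilon>: "\<And>d. d \<in> Obj D \<Longrightarrow> \<epsilon> d \<in> Hom D (fob F (c d)) d"
    and \<epsilon>_iso: "\<And>d. d \<in> Obj D \<Longrightarrow> iso D (\<epsilon> d)"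
    using es unfolding essentially_surjective_def by metis
  \<comment> \<open>an arrow \<open>g : F x \<rightarrow> d\<close> factors as \<open>\<epsilon> d \<circ> F f\<close>, as \<open>F\<close> is full; this \<open>f\<close> is called \<open>L x d g\<close>\<close>
  have "\<exists>f. f \<in> Hom C x (c d) \<and> Comp D (\<epsilon> d) (far F f) = g"
    if x: "x \<in> Obj C" and d: "d \<in> Obj D" and g: "g \<in> Hom D (fob F x) d" for x d g
  proof -
    obtain k where k: "k \<in> Hom D d (fob F (c d))" "Comp D (\<epsilon> d) k = Ident D d"
      using \<epsilon>[OF d] \<epsilon>_iso[OF d] D.iso_Hom_iff by blast
    obtain f where f: "f \<in> Hom C x (c d)" "far F f = Comp D k g"
      using fully_faithfulD(2)[OF ff x c[OF d] D.Comp_Hom[OF k(1) g]] by blast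
    have "Comp D (\<epsilon> d) (Comp D k g) = g"
      using D.assoc_Hom[OF \<epsilon>[OF d] k(1) g] D.Ident_Comp_Hom[OF g] k(2) by simp
    then show ?thesis
      using f by auto
  qed
  then obtain L where L: "\<And>x d g. \<lbrakk>x \<in> Obj C; d \<in> Obj D; g \<in> Hom D (fob F x) d\<rbrakk>
      \<Longrightarrow> L x d g \<in> Hom C x (c d)"
    and \<epsilon>_L: "\<And>x d g. \<lbrakk>x \<in> Obj C; d \<in> Obj D; g \<in> Hom D (fob F x) d\<rbrakk>
      \<Longrightarrow> Comp D (\<epsilon> d) (far F (L x d g)) = g"
    by metis
  have L_unique: "f = f'" if "d \<in> Obj D" "f \<in> Hom C x (c d)" "f' \<in> Hom C x (c d)"
    "Comp D (\<epsilon> d) (far F f) = Comp D (\<epsilon> d) (far F f')" for f f' x d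
  proof (rule fully_faithfulD(1)[OF ff C.Hom_Obj(1)[OF that(2)] c[OF that(1)] that(2,3)])
    show "far F f = far F f'"
      using D.iso_cancel_left[OF \<epsilon>_iso \<epsilon>] is_functor_Hom[OF F] that by blast
  qed
  define G where "G = \<lparr>fob = (\<lambda>d\<in>Obj D. c d),
    far = (\<lambda>g\<in>Arr D. L (c (Dom D g)) (Cod D g) (Comp D g (\<epsilon> (Dom D g))))\<rparr>"
  have Go: "fob G d = c d" if "d \<in> Obj D" for d
    using that by (simp add: G_def)
  have G: "far G g \<in> Hom C (c d) (c e)" "Comp D (\<epsilon> e) (far F (far G g)) = Comp D g (\<epsilon> d)"
    if g: "g \<in> Hom D d e" for g d e
  proof -
    have d: "d \<in> Obj D" and e: "e \<in> Obj D"
      using D.Hom_Obj[OF g] by blast+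
    have "far G g = L (c d) e (Comp D g (\<epsilon> d))"
      using g by (simp add: G_def HomD)
    then show "far G g \<in> Hom C (c d) (c e)" "Comp D (\<epsilon> e) (far F (far G g)) = Comp D g (\<epsilon> d)"
      using L[OF c[OF d] e] \<epsilon>_L[OF c[OF d] e] D.Comp_Hom[OF g \<epsilon>[OF d]] by simp_all
  qed
  have G_functor: "is_functor D C G"
    unfolding is_functor_def
  proof (intro conjI ballI allI impI)
    show "fob G \<in> Obj D \<rightarrow>\<^sub>E Obj C"
      using c by (auto simp: G_def)
    have "far G g \<in> Arr C" if "g \<in> Arr D" for g
      using G(1)[OF HomI[OF that refl refl]] by (rule HomD)
    then show "far G \<in> Arr D \<rightarrow>\<^sub>E Arr C"
      by (simp add: PiE_iff) (simp add: G_def)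
    show "Dom C (far G g) = fob G (Dom D g)" "Cod C (far G g) = fob G (Cod D g)"
      if g: "g \<in> Arr D" for g
      using G(1)[OF HomI[OF g refl refl]] g D.Dom_Obj D.Cod_Obj by (simp_all add: Hom_def Go)
    show "far G (Ident D d) = Ident C (fob G d)" if d: "d \<in> Obj D" for d
    proof (rule L_unique[OF d])
      show "far G (Ident D d) \<in> Hom C (c d) (c d)" "Ident C (fob G d) \<in> Hom C (c d) (c d)"
        using G D.Ident C.Ident c d by (simp_all add: Go)
      show "Comp D (\<epsilon> d) (far F (far G (Ident D d))) = Comp D (\<epsilon> d) (far F (Ident C (fob G d)))"
        using G(2)[OF D.Ident[OF d]] D.Ident_Comp_Hom[OF \<epsilon>[OF d]] D.Comp_Ident_Hom[OF \<epsilon>[OF d]]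
          is_functor_Ident[OF F c[OF d]] by (simp add: Go d)
    qed
    show "far G (Comp D h g) = Comp C (far G h) (far G g)" if "seq D h g" for h g
    proof -
      define d e e' where "d = Dom D g" and "e = Cod D g" and "e' = Cod D h"
      have g: "g \<in> Hom D d e" and h: "h \<in> Hom D e e'"
        using that by (auto simp: seq_def Hom_def d_def e_def e'_def)
      note d = D.Hom_Obj(1)[OF g] and e = D.Hom_Obj(2)[OF g] and e' = D.Hom_Obj(2)[OF h]
      note FG = is_functor_Hom[OF F G(1)]
      show ?thesis
      proof (rule L_unique[OF e'])
        show "far G (Comp D h g) \<in> Hom C (c d) (c e')" "Comp C (far G h) (far G g) \<in> Hom C (c d) (c e')"
          using G(1) D.Comp_Hom[OF h g] C.Comp_Hom[OF G(1)[OF h] G(1)[OF g]] by simp_all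
        have "Comp D (\<epsilon> e') (far F (far G (Comp D h g))) = Comp D (Comp D h g) (\<epsilon> d)"
          by (rule G(2)[OF D.Comp_Hom[OF h g]])
        also have "\<dots> = Comp D h (Comp D (\<epsilon> e) (far F (far G g)))"
          using D.assoc_Hom[OF h g \<epsilon>[OF d]] G(2)[OF g] by simp
        also have "\<dots> = Comp D (Comp D (\<epsilon> e') (far F (far G h))) (far F (far G g))"
          using D.assoc_Hom[OF h \<epsilon>[OF e] FG[OF g]] G(2)[OF h] by simp
        also have "\<dots> = Comp D (\<epsilon> e') (far F (Comp C (far G h) (far G g)))"
          using D.assoc_Hom[OF \<epsilon>[OF e'] FG[OF h] FG[OF g]]
            is_functor_Comp[OF F G(1)[OF h] G(1)[OF g]] by simp
        finally show "Comp D (\<epsilon> e') (far F (far G (Comp D h g)))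
            = Comp D (\<epsilon> e') (far F (Comp C (far G h) (far G g)))" .
      qed
    qed
  qed
  \<comment> \<open>the triangle identity \<open>\<epsilon> (F x) \<circ> F (\<eta> x) = id\<close> dictates the choice of \<open>\<eta>\<close>\<close>
  define \<eta> where "\<eta> x = L x (fob F x) (Ident D (fob F x))" for x
  have \<eta>: "\<eta> x \<in> Hom C x (c (fob F x))"
    "Comp D (\<epsilon> (fob F x)) (far F (\<eta> x)) = Ident D (fob F x)" if x: "x \<in> Obj C" for x
    using L[OF x is_functor_Obj[OF F x]] \<epsilon>_L[OF x is_functor_Obj[OF F x]]
      D.Ident[OF is_functor_Obj[OF F x]] by (simp_all add: \<eta>_def)
  have \<eta>_iso: "iso C (\<eta> x)" if x: "x \<in> Obj C" for x
  proof (rule fully_faithful_reflects_iso[OF C F ff D \<eta>(1)[OF x]])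
    note Fx = is_functor_Obj[OF F x]
    note F\<eta> = is_functor_Hom[OF F \<eta>(1)[OF x]]
    obtain k where k: "k \<in> Hom D (fob F x) (fob F (c (fob F x)))"
      "Comp D k (\<epsilon> (fob F x)) = Ident D (fob F (c (fob F x)))"
      using \<epsilon>[OF Fx] \<epsilon>_iso[OF Fx] D.iso_Hom_iff by blast
    \<comment> \<open>a right inverse of an isomorphism is its two-sided inverse\<close>
    have "far F (\<eta> x) = k"
      using D.assoc_Hom[OF k(1) \<epsilon>[OF Fx] F\<eta>] D.Ident_Comp_Hom[OF F\<eta>] D.Comp_Ident_Hom[OF k(1)]
        k(2) \<eta>(2)[OF x] by simp
    then show "iso D (far F (\<eta> x))"
      using k \<eta>(2)[OF x] \<epsilon>[OF Fx] D.iso_Hom_iff[OF k(1)] by auto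
  qed
  have \<eta>_nat: "Comp C (far G (far F f)) (\<eta> x) = Comp C (\<eta> y) f" if f: "f \<in> Hom C x y" for f x y
  proof (rule L_unique)
    note x = C.Hom_Obj(1)[OF f] and y = C.Hom_Obj(2)[OF f]
    note Fx = is_functor_Obj[OF F x] and Fy = is_functor_Obj[OF F y]
    note Ff = is_functor_Hom[OF F f] and F\<eta> = is_functor_Hom[OF F \<eta>(1)]
    note GFf = G(1)[OF Ff]
    show "fob F y \<in> Obj D" by (rule Fy)
    show "Comp C (far G (far F f)) (\<eta> x) \<in> Hom C x (c (fob F y))"
      "Comp C (\<eta> y) f \<in> Hom C x (c (fob F y))"
      using C.Comp_Hom[OF GFf \<eta>(1)[OF x]] C.Comp_Hom[OF \<eta>(1)[OF y] f] by simp_all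
    have "Comp D (\<epsilon> (fob F y)) (far F (Comp C (far G (far F f)) (\<eta> x)))
        = Comp D (Comp D (\<epsilon> (fob F y)) (far F (far G (far F f)))) (far F (\<eta> x))"
      using is_functor_Comp[OF F GFf \<eta>(1)[OF x]]
        D.assoc_Hom[OF \<epsilon>[OF Fy] is_functor_Hom[OF F GFf] F\<eta>[OF x]] by simp
    also have "\<dots> = far F f"
      using G(2)[OF Ff] D.assoc_Hom[OF Ff \<epsilon>[OF Fx] F\<eta>[OF x]] \<eta>(2)[OF x] D.Comp_Ident_Hom[OF Ff]
      by simp
    also have "\<dots> = Comp D (\<epsilon> (fob F y)) (far F (Comp C (\<eta> y) f))"
      using is_functor_Comp[OF F \<eta>(1)[OF y] f] D.assoc_Hom[OF \<epsilon>[OF Fy] F\<eta>[OF y] Ff]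
        \<eta>(2)[OF y] D.Ident_Comp_Hom[OF Ff] by simp
    finally show "Comp D (\<epsilon> (fob F y)) (far F (Comp C (far G (far F f)) (\<eta> x)))
        = Comp D (\<epsilon> (fob F y)) (far F (Comp C (\<eta> y) f))" .
  qed
  have "natural_isomorphism C C (fctr_id (Obj C) (Arr C)) (fctr_comp (Obj C) (Arr C) G F) \<eta>"
    unfolding natural_isomorphism_def
  proof (intro conjI ballI)
    fix x assume x: "x \<in> Obj C"
    then show "\<eta> x \<in> Hom C (fob (fctr_id (Obj C) (Arr C)) x) (fob (fctr_comp (Obj C) (Arr C) G F) x)"
      "iso C (\<eta> x)"
      using \<eta>(1) \<eta>_iso by (simp_all add: Go is_functor_Obj[OF F])
  next
    fix f assume f: "f \<in> Arr C"
    then show "Comp C (far (fctr_comp (Obj C) (Arr C) G F) f) (\<eta> (Dom C f))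
        = Comp C (\<eta> (Cod C f)) (far (fctr_id (Obj C) (Arr C)) f)"
      using \<eta>_nat[OF HomI[OF f refl refl]] by simp
  qed
  moreover
  have "natural_isomorphism D D (fctr_comp (Obj D) (Arr D) F G) (fctr_id (Obj D) (Arr D)) \<epsilon>"
    unfolding natural_isomorphism_def
  proof (intro conjI ballI)
    fix d assume d: "d \<in> Obj D"
    then show "\<epsilon> d \<in> Hom D (fob (fctr_comp (Obj D) (Arr D) F G) d) (fob (fctr_id (Obj D) (Arr D)) d)"
      "iso D (\<epsilon> d)"
      using \<epsilon> \<epsilon>_iso by (simp_all add: Go)
  next
    fix g assume g: "g \<in> Arr D"
    then show "Comp D (far (fctr_id (Obj D) (Arr D)) g) (\<epsilon> (Dom D g))
        = Comp D (\<epsilon> (Cod D g)) (far (fctr_comp (Obj D) (Arr D) F G) g)"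
      using G(2)[OF HomI[OF g refl refl]] by simp
  qed
  ultimately show ?thesis
    unfolding equivalence_of_categories_def using F G_functor by blast
qed

theorem equivalence_iff_fully_faithful:
  assumes "category C" "category D" "is_functor C D F"
  shows "equivalence_of_categories C D F \<longleftrightarrow> essentially_surjective C D F \<and> fully_faithful C D F"
  using equivalence_imp_fully_faithful[OF assms] fully_faithful_imp_equivalence[OF assms] by blast

section \<open>Operads whose operations are all unary\<close>

definition all_unary :: "('o, 'm, 'x) operad_scheme \<Rightarrow> bool" where
  "all_unary P \<longleftrightarrow> unary P = Mor P"

lemma arity_all_unary: "all_unary P \<Longrightarrow> f \<in> Mor P \<Longrightarrow> arity P f = 1"
  unfolding all_unary_def unary_def by blast

text \<open>
  Morphism sets with a source of length other than one are trivial for the comparison with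
  categories: they are empty on both sides.
\<close>

lemma MHom_empty: "all_unary P \<Longrightarrow> length ps \<noteq> 1 \<Longrightarrow> MHom P ps p = {}"
  using arity_all_unary by (force simp: MHom_def arity_def)

lemma permutes_lessThan_1: "\<sigma> permutes {..<1::nat} \<longleftrightarrow> \<sigma> = id"
  by (simp add: lessThan_Suc permutes_sing)

text \<open>
  The group \<open>\<Sigma>\<^sub>1\<close> is trivial, so a symmetric structure on an operad with only unary operations carries
  no information.
\<close>

lemma acts_all_unary: "all_unary P \<Longrightarrow> acts P \<sigma> f \<longleftrightarrow> f \<in> Mor P \<and> \<sigma> = id"
  using arity_all_unary permutes_lessThan_1 unfolding acts_def by metis

lemma jstar_simps [simp]:
  "Obj (jstar P) = Ob P" "Arr (jstar P) = unary P" "Ident (jstar P) = idn P"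
  "f \<in> unary P \<Longrightarrow> Cod (jstar P) f = tgt P f"
  by (simp_all add: jstar_def)

context operad
begin

lemma src_unary: "f \<in> unary P \<Longrightarrow> src P f = [Dom (jstar P) f]"
  by (cases "src P f") (auto simp: jstar_def unary_def arity_def)

lemma seq_jstar_iff: "seq (jstar P) g f \<longleftrightarrow> g \<in> unary P \<and> f \<in> unary P \<and> src P g = [tgt P f]"
  by (auto simp: seq_def src_unary)

lemma Comp_jstar: "seq (jstar P) g f \<Longrightarrow> Comp (jstar P) g f = cmp P g [f]"
  by (simp add: seq_jstar_iff) (simp add: jstar_def)

lemma mseq_if_seq_jstar: "seq (jstar P) g f \<Longrightarrow> mseq P g [f]"
  by (auto simp: seq_jstar_iff mseq_def unary_def)

lemma MHom_singleton: "MHom P [p] q = Hom (jstar P) p q"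
proof -
  have "f \<in> MHom P [p] q \<longleftrightarrow> f \<in> Hom (jstar P) p q" for f
  proof (cases "f \<in> unary P")
    case True
    then show ?thesis
      using src_unary[OF True] by (simp add: MHom_def Hom_def) (simp add: unary_def)
  next
    case False
    then show ?thesis
      by (auto simp: MHom_def Hom_def unary_def arity_def)
  qed
  then show ?thesis
    by blast
qed

lemma cmp_unary_Hom:
  "seq (jstar P) g f \<Longrightarrow> cmp P g [f] \<in> Hom (jstar P) (Dom (jstar P) f) (Cod (jstar P) g)"
  using cmp[OF mseq_if_seq_jstar] by (simp add: seq_jstar_iff src_unary MHom_singleton)

lemma category_jstar: "category (jstar P)"
proof
  show "Dom (jstar P) \<in> Arr (jstar P) \<rightarrow>\<^sub>E Obj (jstar P)"
  proof (rule PiE_I)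
    fix f assume f: "f \<in> Arr (jstar P)"
    have "set (src P f) \<subseteq> Ob P"
      using f src by (auto simp: unary_def)
    then show "Dom (jstar P) f \<in> Obj (jstar P)"
      using src_unary[of f] f by simp
  qed (simp add: jstar_def)
  show "Cod (jstar P) \<in> Arr (jstar P) \<rightarrow>\<^sub>E Obj (jstar P)"
    using tgt by (auto simp: jstar_def unary_def)
  show "Ident (jstar P) \<in> extensional (Obj (jstar P))"
    using idn_ext by simp
  show "Ident (jstar P) x \<in> Hom (jstar P) x x" if "x \<in> Obj (jstar P)" for x
    using idn that by (simp add: MHom_singleton)
  show "Comp (jstar P) g f = undefined" if "\<not> seq (jstar P) g f" for g f
    using that unfolding seq_jstar_iff by (auto simp: jstar_def)
  show "Comp (jstar P) g f \<in> Hom (jstar P) (Dom (jstar P) f) (Cod (jstar P) g)"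
    if "seq (jstar P) g f" for g f
    using that cmp_unary_Hom by (simp add: Comp_jstar)
  fix f assume f: "f \<in> Arr (jstar P)"
  then have fm: "f \<in> Mor P"
    by (simp add: unary_def)
  show "Comp (jstar P) f (Ident (jstar P) (Dom (jstar P) f)) = f"
  proof -
    have d: "Dom (jstar P) f \<in> Ob P"
      using src fm src_unary[of f] f by (auto simp: PiE_iff Pi_iff)
    have "seq (jstar P) f (idn P (Dom (jstar P) f))"
      using f idn[OF d] by (simp add: seq_def Hom_def MHom_singleton)
    then show ?thesis
      using cmp_idn[OF fm] src_unary[of f] f by (simp add: Comp_jstar)
  qed
  show "Comp (jstar P) (Ident (jstar P) (Cod (jstar P) f)) f = f"
  proof -
    have "tgt P f \<in> Ob P"
      using tgt fm by auto
    then have "seq (jstar P) (idn P (tgt P f)) f"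
      using f idn[of "tgt P f"] by (simp add: seq_def Hom_def MHom_singleton)
    then show ?thesis
      using idn_cmp[OF fm] f by (simp add: Comp_jstar)
  qed
next
  fix h g f assume hg: "seq (jstar P) h g" and gf: "seq (jstar P) g f"
  have "seq (jstar P) h (cmp P g [f])" "seq (jstar P) (cmp P h [g]) f"
    using hg gf cmp_unary_Hom[OF hg] cmp_unary_Hom[OF gf] by (simp_all add: seq_def Hom_def)
  then show "Comp (jstar P) h (Comp (jstar P) g f) = Comp (jstar P) (Comp (jstar P) h g) f"
    using hg gf cmp_assoc[OF mseq_if_seq_jstar[OF hg], of "[[f]]"] mseq_if_seq_jstar[OF gf]
    by (simp add: Comp_jstar)
qed

text \<open>
  As the source of \<open>g\<close> has length one, so has every list composable with \<open>g\<close>.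
\<close>

lemma mseq_all_unary:
  assumes "all_unary P"
  shows "mseq P g fs \<longleftrightarrow> (\<exists>f. fs = [f] \<and> seq (jstar P) g f)"
proof
  assume m: "mseq P g fs"
  then have g: "g \<in> unary P"
    using assms by (simp add: all_unary_def mseq_def)
  then obtain f where "fs = [f]"
    using m src_unary[OF g] by (auto simp: mseq_def)
  then show "\<exists>f. fs = [f] \<and> seq (jstar P) g f"
    using m g assms by (auto simp: mseq_def seq_jstar_iff all_unary_def)
qed (auto dest: mseq_if_seq_jstar)

end

lemma jstar_fctr_eq:
  assumes "all_unary P" "far F \<in> extensional (Mor P)"
  shows "jstar_fctr P F = F"
  using assms by (simp add: jstar_fctr_def all_unary_def extensional_restrict)

lemma operad_functor_iff_is_functor:
  assumes P: "operad P" "all_unary P" and Q: "operad Q" "all_unary Q"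
  shows "operad_functor P Q F \<longleftrightarrow> is_functor (jstar P) (jstar Q) F"
proof -
  interpret P: operad P by fact
  interpret Q: operad Q by fact
  have U: "unary P = Mor P" "unary Q = Mor Q"
    using P Q by (simp_all add: all_unary_def)
  have "far F (cmp P g [f]) = cmp Q (far F g) [far F f] \<longleftrightarrow>
      far F (Comp (jstar P) g f) = Comp (jstar Q) (far F g) (far F f)"
    if "seq (jstar P) g f" "far F \<in> Mor P \<rightarrow>\<^sub>E Mor Q"
      "\<forall>f\<in>Mor P. src Q (far F f) = map (fob F) (src P f) \<and> tgt Q (far F f) = fob F (tgt P f)" for g f
  proof -
    have "seq (jstar Q) (far F g) (far F f)"
      using that by (auto simp: P.seq_jstar_iff Q.seq_jstar_iff U)
    then show ?thesis
      using that(1) by (simp add: P.Comp_jstar Q.Comp_jstar)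
  qed
  moreover have "src Q (far F f) = map (fob F) (src P f) \<and> tgt Q (far F f) = fob F (tgt P f)
      \<longleftrightarrow> Dom (jstar Q) (far F f) = fob F (Dom (jstar P) f)
        \<and> Cod (jstar Q) (far F f) = fob F (Cod (jstar P) f)"
    if "f \<in> Mor P" "far F \<in> Mor P \<rightarrow>\<^sub>E Mor Q" for f
  proof -
    have "f \<in> unary P" "far F f \<in> unary Q"
      using that by (auto simp: U)
    then show ?thesis
      using P.src_unary[of f] Q.src_unary[of "far F f"] by simp
  qed
  ultimately show ?thesis
    unfolding operad_functor_def is_functor_def P.mseq_all_unary[OF P(2)] jstar_simps U
    by (auto simp: U)
qed

text \<open>
  Functors of operads preserve arity, so only operads without operations of arity other than one
  admit a functor to the point.
\<close>

lemma all_unary_if_functor: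
  assumes "operad_functor P Q F" "all_unary Q"
  shows "all_unary P"
proof -
  have "arity P f = 1" if "f \<in> Mor P" for f
  proof -
    have "src Q (far F f) = map (fob F) (src P f)" "far F f \<in> Mor Q"
      using assms that by (auto simp: operad_functor_def)
    then show ?thesis
      using arity_all_unary[OF assms(2), of "far F f"] by (simp add: arity_def)
  qed
  then show ?thesis
    by (auto simp: all_unary_def unary_def)
qed

text \<open>
  For sources of length one both conditions are the same. For other lengths the operad condition
  is about a function between empty sets, as \<open>F\<close> preserves the length of a source.
\<close>

lemma fully_faithful_jstar_iff:
  assumes P: "operad P" "all_unary P" and Q: "operad Q" "all_unary Q"
    and F: "is_functor (jstar P) (jstar Q) F"
  shows "(\<forall>ps\<in>lists (Ob P). \<forall>p\<in>Ob P.
      bij_betw (far F) (MHom P ps p) (MHom Q (map (fob F) ps) (fob F p)))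
    \<longleftrightarrow> fully_faithful (jstar P) (jstar Q) F" (is "?L \<longleftrightarrow> ?R")
proof
  interpret P: operad P by fact
  interpret Q: operad Q by fact
  show ?R if L: ?L
    unfolding fully_faithful_def
  proof (intro ballI)
    fix x y assume "x \<in> Obj (jstar P)" "y \<in> Obj (jstar P)"
    then show "bij_betw (far F) (Hom (jstar P) x y) (Hom (jstar Q) (fob F x) (fob F y))"
      using L[rule_format, of "[x]" y] by (simp add: P.MHom_singleton Q.MHom_singleton)
  qed
  show ?L if R: ?R
  proof (intro ballI)
    fix ps p assume *: "ps \<in> lists (Ob P)" "p \<in> Ob P"
    show "bij_betw (far F) (MHom P ps p) (MHom Q (map (fob F) ps) (fob F p))"
    proof (cases "length ps = 1")
      case True
      then obtain x where "ps = [x]"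
        by (auto simp: length_Suc_conv)
      then show ?thesis
        using * R by (simp add: P.MHom_singleton Q.MHom_singleton fully_faithful_def)
    next
      case False
      then show ?thesis
        using MHom_empty[OF P(2), of ps] MHom_empty[OF Q(2), of "map (fob F) ps"]
        by (simp add: bij_betw_def)
    qed
  qed
qed

lemma operad_weq_iff_equivalence:
  assumes P: "operad P" "all_unary P" and Q: "operad Q" "all_unary Q"
    and F: "is_functor (jstar P) (jstar Q) F"
  shows "operad_weq P Q F \<longleftrightarrow> equivalence_of_categories (jstar P) (jstar Q) F"
proof -
  have "jstar_fctr P F = F"
    using F P by (intro jstar_fctr_eq) (simp_all add: is_functor_def all_unary_def PiE_iff)
  then show ?thesis
    unfolding operad_weq_def fully_faithful_jstar_iff[OF assms]
    using equivalence_iff_fully_faithful[OF operad.category_jstar[OF P(1)]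
      operad.category_jstar[OF Q(1)] F] by simp
qed

lemma operad_fib_iff_isofibration:
  assumes "operad P" "operad Q"
  shows "operad_fib P Q F \<longleftrightarrow> isofibration (jstar P) (jstar Q) F"
proof -
  interpret P: operad P by fact
  interpret Q: operad Q by fact
  have P: "src P \<phi> = [p] \<longleftrightarrow> Dom (jstar P) \<phi> = p" if "iso (jstar P) \<phi>" for \<phi> p
    using category.iso_Arr[OF P.category_jstar that] by (simp add: P.src_unary)
  have Q: "src Q \<psi> = [p] \<longleftrightarrow> Dom (jstar Q) \<psi> = p" if "iso (jstar Q) \<psi>" for \<psi> p
    using category.iso_Arr[OF Q.category_jstar that] by (simp add: Q.src_unary)
  show ?thesis
    unfolding operad_fib_def isofibration_def jstar_simps by (simp add: P Q cong: conj_cong)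
qed

section \<open>A category as an operad\<close>

text \<open>
  Lists of length other than one are never composable here, hence the default value \<open>undefined\<close>.
\<close>

definition operad_of_category :: "('o, 'm) category \<Rightarrow> ('o, 'm) operad" where
  "operad_of_category C =
     \<lparr>Ob = Obj C, Mor = Arr C, src = (\<lambda>f\<in>Arr C. [Dom C f]), tgt = Cod C, idn = Ident C,
      cmp = (\<lambda>g fs. case fs of [f] \<Rightarrow> Comp C g f | _ \<Rightarrow> undefined)\<rparr>"

lemma operad_of_category_simps [simp]:
  "Ob (operad_of_category C) = Obj C"
  "Mor (operad_of_category C) = Arr C"
  "f \<in> Arr C \<Longrightarrow> src (operad_of_category C) f = [Dom C f]"
  "tgt (operad_of_category C) = Cod C"
  "idn (operad_of_category C) = Ident C"
  "cmp (operad_of_category C) g [f] = Comp C g f"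
  by (simp_all add: operad_of_category_def)

lemma all_unary_operad_of_category: "all_unary (operad_of_category C)"
  by (auto simp: all_unary_def unary_def arity_def)

lemma mseq_operad_of_category:
  "mseq (operad_of_category C) g fs \<longleftrightarrow> (\<exists>f. fs = [f] \<and> seq C g f)"
  by (auto simp: mseq_def seq_def)

lemma operad_operad_of_category:
  assumes "category C"
  shows "operad (operad_of_category C)" (is "operad ?P")
proof
  interpret category C by fact
  show "src ?P \<in> Mor ?P \<rightarrow>\<^sub>E lists (Ob ?P)"
    using Dom_Obj by (auto simp: operad_of_category_def)
  show "tgt ?P \<in> Mor ?P \<rightarrow>\<^sub>E Ob ?P"
    using Cod by simp
  show "idn ?P \<in> extensional (Ob ?P)"
    using Ident_ext by simp
  show "idn ?P p \<in> MHom ?P [p] p" if "p \<in> Ob ?P" for p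
    using Ident[of p] that by (simp add: MHom_def Hom_def)
  show "cmp ?P g fs = undefined" if "\<not> mseq ?P g fs" for g fs
    using that Comp_ext unfolding mseq_operad_of_category
    by (auto simp: operad_of_category_def split: list.splits)
  show "cmp ?P g fs \<in> MHom ?P (concat (map (src ?P) fs)) (tgt ?P g)" if "mseq ?P g fs" for g fs
    using that Comp unfolding mseq_operad_of_category
    by (auto simp: MHom_def Hom_def seq_def)
  show "cmp ?P f (map (idn ?P) (src ?P f)) = f" "cmp ?P (idn ?P (tgt ?P f)) [f] = f"
    if "f \<in> Mor ?P" for f
    using that Comp_Ident Ident_Comp by simp_all
  show "cmp ?P h (map2 (cmp ?P) gs fss) = cmp ?P (cmp ?P h gs) (concat fss)"
    if "mseq ?P h gs" "list_all2 (mseq ?P) gs fss" for h gs fss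
    using that Comp_assoc unfolding mseq_operad_of_category
    by (auto simp: list_all2_Cons1 mseq_operad_of_category)
qed

lemma jstar_operad_of_category:
  assumes "category C"
  shows "jstar (operad_of_category C) = C"
proof -
  interpret category C by fact
  interpret P: operad "operad_of_category C"
    using assms by (rule operad_operad_of_category)
  have U: "unary (operad_of_category C) = Arr C"
    using all_unary_operad_of_category[of C] by (simp add: all_unary_def)
  show ?thesis
  proof (rule category.equality)
    show "Dom (jstar (operad_of_category C)) = Dom C"
      using Dom unfolding jstar_def by (auto simp: U fun_eq_iff PiE_iff extensional_def)
    show "Cod (jstar (operad_of_category C)) = Cod C"
      using Cod unfolding jstar_def by (auto simp: U fun_eq_iff PiE_iff extensional_def)
    show "Comp (jstar (operad_of_category C)) = Comp C"
      using Comp_ext unfolding jstar_def by (auto simp: U fun_eq_iff seq_def)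
  qed (simp_all add: U)
qed

text \<open>
  The operad is recovered as a record, not just up to isomorphism, because its structure maps are
  \<open>undefined\<close> outside of their domain. The truncation forgets additional structure such as a
  symmetric group action.
\<close>

lemma operad_of_category_jstar:
  assumes "operad P" "all_unary P"
  shows "operad_of_category (jstar P) = operad.truncate P"
proof -
  interpret operad P by fact
  have U: "unary P = Mor P"
    using assms by (simp add: all_unary_def)
  have "src P = (\<lambda>f\<in>Mor P. [Dom (jstar P) f])"
    using src src_unary U by (auto simp: fun_eq_iff PiE_iff extensional_def)
  moreover have "tgt P = Cod (jstar P)"
    using tgt U by (auto simp: jstar_def fun_eq_iff PiE_iff extensional_def)
  moreover have "cmp P g fs = (case fs of [f] \<Rightarrow> Comp (jstar P) g f | _ \<Rightarrow> undefined)" for g fs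
  proof (cases "mseq P g fs")
    case True
    then show ?thesis
      using Comp_jstar by (auto simp: mseq_all_unary[OF assms(2)])
  next
    case False
    then show ?thesis
      using cmp_ext[OF False] category.Comp_ext[OF category_jstar]
      by (auto simp: mseq_all_unary[OF assms(2)] split: list.splits)
  qed
  ultimately show ?thesis
    by (simp add: operad_of_category_def operad.truncate_def U fun_eq_iff)
qed

section \<open>A category as a symmetric operad\<close>

definition sym_operad_of_category :: "('o, 'm) category \<Rightarrow> ('o, 'm) sym_operad" where
  "sym_operad_of_category C = operad.extend (operad_of_category C)
     \<lparr>act = (\<lambda>\<sigma> f. if f \<in> Arr C \<and> \<sigma> permutes {..<1} then f else undefined)\<rparr>"

lemma extend_simps [simp]:
  fixes P :: "('o, 'm) operad"
  shows "Ob (operad.extend P x) = Ob P" "Mor (operad.extend P x) = Mor P"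
    "src (operad.extend P x) = src P" "tgt (operad.extend P x) = tgt P"
    "idn (operad.extend P x) = idn P" "cmp (operad.extend P x) = cmp P"
  by (simp_all add: operad.extend_def)

lemma extend_derived_simps [simp]:
  fixes P :: "('o, 'm) operad"
  shows "MHom (operad.extend P x) = MHom P" "mseq (operad.extend P x) = mseq P"
    "arity (operad.extend P x) = arity P" "unary (operad.extend P x) = unary P"
    "jstar (operad.extend P x) = jstar P" "all_unary (operad.extend P x) = all_unary P"
  by (simp_all add: fun_eq_iff MHom_def mseq_def arity_def unary_def jstar_def all_unary_def)

lemma operad_extend:
  fixes P :: "('o, 'm) operad"
  shows "operad P \<Longrightarrow> operad (operad.extend P x)"
  by (simp add: operad_def)

text \<open>
  For unary operations the two families of permutations in the equivariance axioms reduce to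
  identities.
\<close>

lemma block_perm_id_1: "block_perm id [1] = id"
  by (auto simp: block_perm_def blocks_def fun_eq_iff)

lemma sum_perm_id_1: "sum_perm [id] [1] = id"
  by (auto simp: sum_perm_def blocks_def fun_eq_iff)

lemma sym_operad_sym_operad_of_category:
  assumes "category C"
  shows "sym_operad (sym_operad_of_category C)" (is "sym_operad ?P")
proof -
  interpret operad ?P
    unfolding sym_operad_of_category_def by (intro operad_extend operad_operad_of_category assms)
  interpret C: category C by fact
  have U: "all_unary ?P"
    by (simp add: sym_operad_of_category_def all_unary_operad_of_category)
  have mor: "Mor ?P = Arr C"
    by (simp add: sym_operad_of_category_def)
  have J: "jstar ?P = C"
    by (simp add: sym_operad_of_category_def jstar_operad_of_category[OF assms])
  have acts: "acts ?P \<sigma> f \<longleftrightarrow> f \<in> Arr C \<and> \<sigma> = id" for \<sigma> f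
    using acts_all_unary[OF U] by (simp add: mor)
  have act: "act ?P \<sigma> f = (if f \<in> Arr C \<and> \<sigma> = id then f else undefined)" for \<sigma> f
    unfolding sym_operad_of_category_def permutes_lessThan_1 by (simp add: operad.extend_def)
  have arity: "arity ?P f = 1" if "f \<in> Arr C" for f
    using arity_all_unary[OF U] that by (simp add: mor)
  show ?thesis
  proof
    show "act ?P \<sigma> f = undefined" if "\<not> acts ?P \<sigma> f" for \<sigma> f
      using that unfolding act acts by (rule if_not_P)
    show "act ?P \<sigma> f \<in> MHom ?P (permute_list \<sigma> (src ?P f)) (tgt ?P f)" if "acts ?P \<sigma> f" for \<sigma> f
      using that by (simp add: act acts MHom_def mor)
    show "act ?P id f = f" if "f \<in> Mor ?P" for f
      using that by (simp add: act acts mor)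
    show "act ?P \<tau> (act ?P \<sigma> f) = act ?P (\<sigma> \<circ> \<tau>) f" if "acts ?P \<sigma> f" "acts ?P \<tau> f" for \<sigma> \<tau> f
      using that by (simp add: act acts)
    show "cmp ?P (act ?P \<sigma> g) (permute_list \<sigma> fs)
        = act ?P (block_perm \<sigma> (map (arity ?P) fs)) (cmp ?P g fs)"
      if m: "mseq ?P g fs" and "acts ?P \<sigma> g" for g fs \<sigma>
    proof -
      obtain f where f: "fs = [f]" "f \<in> Arr C"
        using m by (auto simp: mseq_all_unary[OF U] J seq_def)
      have "cmp ?P g fs \<in> Arr C"
        using cmp[OF that(1)] by (simp add: MHom_def mor)
      then show ?thesis
        using that(2) by (simp add: f arity act acts block_perm_id_1[simplified])
    qed
    show "cmp ?P g (map2 (act ?P) \<tau>s fs) = act ?P (sum_perm \<tau>s (map (arity ?P) fs)) (cmp ?P g fs)"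
      if m: "mseq ?P g fs" and "list_all2 (acts ?P) \<tau>s fs" for g fs \<tau>s
    proof -
      obtain f where f: "fs = [f]" "f \<in> Arr C"
        using m by (auto simp: mseq_all_unary[OF U] J seq_def)
      have "\<tau>s = [id]"
        using that(2) by (auto simp: f list_all2_Cons2 acts)
      moreover have "cmp ?P g fs \<in> Arr C"
        using cmp[OF that(1)] by (simp add: MHom_def mor)
      ultimately show ?thesis
        by (simp add: f arity act acts sum_perm_id_1[simplified])
    qed
  qed
qed

lemma sym_operad_of_category_jstar:
  fixes P :: "('o, 'm) sym_operad"
  assumes "sym_operad P" "all_unary P"
  shows "sym_operad_of_category (jstar P) = P"
proof -
  interpret sym_operad P by fact
  have U: "unary P = Mor P"
    using assms by (simp add: all_unary_def)
  have "act P \<sigma> f = (if f \<in> Mor P \<and> \<sigma> permutes {..<1} then f else undefined)" for \<sigma> f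
    using act_id[of f] act_ext[of \<sigma> f] acts_all_unary[OF assms(2), of \<sigma> f]
    by (simp add: permutes_lessThan_1[simplified])
  then have "act P = (\<lambda>\<sigma> f. if f \<in> Mor P \<and> \<sigma> permutes {..<1} then f else undefined)"
    by (simp add: fun_eq_iff)
  then show ?thesis
    by (simp add: sym_operad_of_category_def operad_of_category_jstar[OF operad_axioms assms(2)]
        operad.extend_def operad.truncate_def U)
qed

lemma sym_operad_functor_if_operad_functor:
  assumes P: "sym_operad P" "all_unary P" and Q: "sym_operad Q"
    and F: "operad_functor P Q F"
  shows "sym_operad_functor P Q F"
  unfolding sym_operad_functor_def
proof (intro conjI F allI impI)
  fix \<sigma> f assume a: "acts P \<sigma> f"
  then have f: "f \<in> Mor P" and "\<sigma> = id"
    by (simp_all add: acts_all_unary[OF P(2)])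
  moreover have "far F f \<in> Mor Q"
    using f F by (auto simp: operad_functor_def)
  ultimately show "far F (act P \<sigma> f) = act Q \<sigma> (far F f)"
    using sym_operad.act_id[OF P(1)] sym_operad.act_id[OF Q] by simp
qed

section \<open>The slice category over the point\<close>

lemma Arr_Cat_iff: "(C, F, D) \<in> Arr Cat \<longleftrightarrow> category C \<and> category D \<and> is_functor C D F"
  by (simp add: Cat_def structure_category_simps)

lemma Cat_simps:
  "Obj Cat = {C. category C}"
  "(C, F, D) \<in> Arr Cat \<Longrightarrow> Dom Cat (C, F, D) = C"
  "(C, F, D) \<in> Arr Cat \<Longrightarrow> Cod Cat (C, F, D) = D"
  "category C \<Longrightarrow> Ident Cat C = (C, fctr_id (Obj C) (Arr C), C)"
  "(C, F, D) \<in> Arr Cat \<Longrightarrow> (D, G, E) \<in> Arr Cat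
    \<Longrightarrow> Comp Cat (D, G, E) (C, F, D) = (C, fctr_comp (Obj C) (Arr C) G F, E)"
  by (simp_all add: Cat_def structure_category_simps)

definition const_fctr :: "'o set \<Rightarrow> 'm set \<Rightarrow> 'p \<Rightarrow> 'n \<Rightarrow> ('o, 'm, 'p, 'n) fctr" where
  "const_fctr A M a u = \<lparr>fob = (\<lambda>x\<in>A. a), far = (\<lambda>f\<in>M. u)\<rparr>"

text \<open>
  A category with one object and one arrow is terminal. This makes an object of the slice category
  the same as an operad with only unary operations, and every functor between two of them
  automatically a functor over the point.
\<close>

lemma is_functor_point_iff:
  assumes C: "category C" and D: "category D" and pt: "Obj D = {a}" "Arr D = {u}"
  shows "is_functor C D F \<longleftrightarrow> F = const_fctr (Obj C) (Arr C) a u"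
proof
  interpret C: category C by fact
  interpret D: category D by fact
  show "F = const_fctr (Obj C) (Arr C) a u" if "is_functor C D F"
    using that by (auto simp: is_functor_def pt const_fctr_def PiE_iff
        intro!: fctr_eqI[of _ "Obj C" _ "Arr C"])
  have u: "Dom D u = a" "Cod D u = a"
    using D.Dom_Obj[of u] D.Cod_Obj[of u] by (simp_all add: pt)
  have "Ident D a = u"
    using D.Ident[of a] by (simp add: pt Hom_def)
  moreover have "Comp D u u = u"
    using D.Comp[of u u] u by (simp add: pt Hom_def seq_def)
  ultimately show "is_functor C D F" if "F = const_fctr (Obj C) (Arr C) a u"
    unfolding that is_functor_def
    using C.Dom_Obj C.Cod_Obj C.Ident C.Comp u
    by (auto simp: pt const_fctr_def Hom_def seq_def)
qed

text \<open>
  What the comparison uses of a category \<open>structure_category S Ob Mor H\<close> of operads, with or without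
  symmetric group actions: \<open>E\<close> is the inverse of \<open>jstar\<close> on operads with only unary operations, between
  such operads all functors of operads belong to \<open>H\<close>, and \<open>pt\<close> has one object and one morphism.
\<close>

locale operads_over_point =
  fixes S :: "('o, 'm, 'x) operad_scheme set"
    and H :: "('o, 'm, 'x) operad_scheme \<Rightarrow> ('o, 'm, 'x) operad_scheme
      \<Rightarrow> ('o, 'm, 'o, 'm) fctr \<Rightarrow> bool"
    and E :: "('o, 'm) category \<Rightarrow> ('o, 'm, 'x) operad_scheme"
    and pt :: "('o, 'm, 'x) operad_scheme"
    and a :: 'o and u :: 'm
  assumes operad_S: "P \<in> S \<Longrightarrow> operad P"
    and category_K: "category (structure_category S Ob Mor H)"
    and H_imp: "P \<in> S \<Longrightarrow> Q \<in> S \<Longrightarrow> H P Q F \<Longrightarrow> operad_functor P Q F"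
    and H_if: "\<lbrakk>P \<in> S; Q \<in> S; all_unary P; operad_functor P Q F\<rbrakk> \<Longrightarrow> H P Q F"
    and E: "category C \<Longrightarrow> E C \<in> S" "all_unary (E C)" "category C \<Longrightarrow> jstar (E C) = C"
    and E_jstar: "P \<in> S \<Longrightarrow> all_unary P \<Longrightarrow> E (jstar P) = P"
    and pt: "pt \<in> S" "all_unary pt" "Ob pt = {a}" "Mor pt = {u}"
begin

abbreviation "K \<equiv> structure_category S Ob Mor H"

abbreviation "slice_K \<equiv> slice K pt"

abbreviation "J \<equiv> slice_jstar K pt"

definition U :: "('o, 'm, 'x) operad_scheme set" where
  "U = {P \<in> S. all_unary P}"

definition over_pt :: "('o, 'm, 'x) operad_scheme
    \<Rightarrow> ('o, 'm, 'x) operad_scheme \<times> ('o, 'm, 'o, 'm) fctr \<times> ('o, 'm, 'x) operad_scheme" where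
  "over_pt P = (P, const_fctr (Ob P) (Mor P) a u, pt)"

lemma U: "P \<in> U \<Longrightarrow> P \<in> S" "P \<in> U \<Longrightarrow> operad P" "P \<in> U \<Longrightarrow> all_unary P"
  "P \<in> U \<Longrightarrow> unary P = Mor P"
  using operad_S by (auto simp: U_def all_unary_def)

lemma category_jstar_U: "P \<in> U \<Longrightarrow> category (jstar P)"
  using U operad.category_jstar by blast

lemma H_iff_is_functor: "P \<in> U \<Longrightarrow> Q \<in> U \<Longrightarrow> H P Q F \<longleftrightarrow> is_functor (jstar P) (jstar Q) F"
  using H_imp H_if U operad_functor_iff_is_functor by metis

lemma H_pt_iff:
  assumes "P \<in> S"
  shows "H P pt F \<longleftrightarrow> P \<in> U \<and> F = const_fctr (Ob P) (Mor P) a u"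
proof -
  have ptU: "pt \<in> U"
    using pt by (simp add: U_def)
  have "H P pt F \<Longrightarrow> P \<in> U"
    using assms H_imp[OF assms pt(1)] all_unary_if_functor pt(2) by (auto simp: U_def)
  moreover have "H P pt F \<longleftrightarrow> F = const_fctr (Ob P) (Mor P) a u" if P: "P \<in> U"
    unfolding H_iff_is_functor[OF P ptU]
    using is_functor_point_iff[OF category_jstar_U[OF P] category_jstar_U[OF ptU], of a u F]
    by (simp add: pt U(4)[OF P] U(4)[OF ptU])
  ultimately show ?thesis by blast
qed

lemma Obj_slice_K: "X \<in> Obj slice_K \<longleftrightarrow> (\<exists>P\<in>U. X = over_pt P)"
proof -
  obtain P F Q where X: "X = (P, F, Q)"
    by (cases X)
  have "X \<in> Obj slice_K \<longleftrightarrow> P \<in> S \<and> H P pt F \<and> Q = pt"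
    using pt(1) by (auto simp: X slice_simps(1) structure_category_simps)
  also have "\<dots> \<longleftrightarrow> P \<in> U \<and> F = const_fctr (Ob P) (Mor P) a u \<and> Q = pt"
    using H_pt_iff U(1) by blast
  finally show ?thesis
    by (auto simp: X over_pt_def)
qed

lemma Dom_over_pt: "P \<in> U \<Longrightarrow> Dom K (over_pt P) = P"
  using H_pt_iff[of P] U(1) pt(1) by (simp add: over_pt_def structure_category_simps)

text \<open>
  The triangle over the point commutes for free: the composite with the structure map of \<open>Q\<close> is a
  functor from \<open>P\<close> to the point, and there is only one.
\<close>

lemma Arr_slice_K: "Z \<in> Arr slice_K \<longleftrightarrow>
  (\<exists>P\<in>U. \<exists>Q\<in>U. \<exists>F. is_functor (jstar P) (jstar Q) F \<and> Z = (over_pt P, (P, F, Q), over_pt Q))"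
proof
  interpret K: category K by (rule category_K)
  assume Z: "Z \<in> Arr slice_K"
  obtain X f Y where XY: "Z = (X, f, Y)"
    by (cases Z)
  obtain P Q where PQ: "P \<in> U" "Q \<in> U" "X = over_pt P" "Y = over_pt Q"
    using Z by (auto simp: XY slice_simps(2) Obj_slice_K)
  have "f \<in> Hom K P Q"
    using Z by (simp add: XY slice_simps(2) PQ Dom_over_pt)
  then obtain F where "f = (P, F, Q)" "H P Q F"
    by (cases f) (auto simp: Hom_def structure_category_simps)
  then show "\<exists>P\<in>U. \<exists>Q\<in>U. \<exists>F. is_functor (jstar P) (jstar Q) F
      \<and> Z = (over_pt P, (P, F, Q), over_pt Q)"
    using PQ XY H_iff_is_functor by blast
next
  assume "\<exists>P\<in>U. \<exists>Q\<in>U. \<exists>F. is_functor (jstar P) (jstar Q) F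
      \<and> Z = (over_pt P, (P, F, Q), over_pt Q)"
  then obtain P Q F where P: "P \<in> U" and Q: "Q \<in> U" and F: "is_functor (jstar P) (jstar Q) F"
    and Z: "Z = (over_pt P, (P, F, Q), over_pt Q)" by blast
  interpret K: category K by (rule category_K)
  have f: "(P, F, Q) \<in> Hom K P Q"
    using P Q F U(1) by (simp add: Hom_def structure_category_simps H_iff_is_functor)
  have q: "over_pt Q \<in> Hom K Q pt"
    using Q Obj_slice_K[of "over_pt Q"] by (auto simp: Hom_def Dom_over_pt slice_simps(1))
  have pf: "Comp K (over_pt Q) (P, F, Q) \<in> Hom K P pt"
    by (rule K.Comp_Hom[OF q f])
  then obtain G where G: "Comp K (over_pt Q) (P, F, Q) = (P, G, pt)" "H P pt G"
    by (cases "Comp K (over_pt Q) (P, F, Q)") (auto simp: Hom_def structure_category_simps)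
  then have "Comp K (over_pt Q) (P, F, Q) = over_pt P"
    using H_pt_iff[OF U(1)[OF P]] by (simp add: over_pt_def)
  then show "Z \<in> Arr slice_K"
    using P Q f by (auto simp: Z slice_simps(2) Obj_slice_K Dom_over_pt)
qed

lemma J_simps:
  "P \<in> U \<Longrightarrow> fob J (over_pt P) = jstar P"
  "\<lbrakk>P \<in> U; Q \<in> U; is_functor (jstar P) (jstar Q) F\<rbrakk>
    \<Longrightarrow> far J (over_pt P, (P, F, Q), over_pt Q) = (jstar P, F, jstar Q)"
proof -
  show "fob J (over_pt P) = jstar P" if "P \<in> U"
    using that Obj_slice_K[of "over_pt P"] by (auto simp: slice_jstar_def) (simp add: over_pt_def)
  show "far J (over_pt P, (P, F, Q), over_pt Q) = (jstar P, F, jstar Q)"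
    if *: "P \<in> U" "Q \<in> U" "is_functor (jstar P) (jstar Q) F"
  proof -
    have "jstar_fctr P F = F"
      using * U by (intro jstar_fctr_eq) (simp_all add: is_functor_def PiE_iff)
    moreover have "(over_pt P, (P, F, Q), over_pt Q) \<in> Arr slice_K"
      using * Arr_slice_K by blast
    ultimately show ?thesis
      by (simp add: slice_jstar_def)
  qed
qed

lemma Arr_slice_K_intro:
  "\<lbrakk>P \<in> U; Q \<in> U; is_functor (jstar P) (jstar Q) F\<rbrakk>
    \<Longrightarrow> (over_pt P, (P, F, Q), over_pt Q) \<in> Arr slice_K"
  using Arr_slice_K by blast

lemma J_Cat:
  "\<lbrakk>P \<in> U; Q \<in> U; is_functor (jstar P) (jstar Q) F\<rbrakk> \<Longrightarrow> (jstar P, F, jstar Q) \<in> Arr Cat"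
  by (simp add: Arr_Cat_iff category_jstar_U)

text \<open>
  For a functor \<open>F\<close> defined on an operad with only unary operations \<open>jstar_fctr P F\<close> equals \<open>F\<close>, so \<open>J\<close>
  changes the operads at both ends and leaves the functor as it is.
\<close>

lemma is_functor_J: "is_functor slice_K Cat J"
  unfolding is_functor_def
proof (intro conjI ballI allI impI)
  show "fob J \<in> Obj slice_K \<rightarrow>\<^sub>E Obj Cat"
  proof (rule PiE_I)
    show "fob J X \<in> Obj Cat" if "X \<in> Obj slice_K" for X
      using that by (auto simp: Obj_slice_K J_simps(1) Cat_simps(1) category_jstar_U)
  qed (simp add: slice_jstar_def)
  show "far J \<in> Arr slice_K \<rightarrow>\<^sub>E Arr Cat"
  proof (rule PiE_I)
    show "far J Z \<in> Arr Cat" if "Z \<in> Arr slice_K" for Z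
      using that by (auto simp: Arr_slice_K J_simps(2) J_Cat)
  qed (simp add: slice_jstar_def)
next
  fix Z assume "Z \<in> Arr slice_K"
  then obtain P Q F where *: "P \<in> U" "Q \<in> U" "is_functor (jstar P) (jstar Q) F"
    "Z = (over_pt P, (P, F, Q), over_pt Q)" by (auto simp: Arr_slice_K)
  note Z = Arr_slice_K_intro[OF *(1-3)]
  show "Dom Cat (far J Z) = fob J (Dom slice_K Z)"
    unfolding *(4) slice_simps(3)[OF Z] J_simps(2)[OF *(1-3)] J_simps(1)[OF *(1)]
    by (rule Cat_simps(2)[OF J_Cat[OF *(1-3)]])
  show "Cod Cat (far J Z) = fob J (Cod slice_K Z)"
    unfolding *(4) slice_simps(4)[OF Z] J_simps(2)[OF *(1-3)] J_simps(1)[OF *(2)]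
    by (rule Cat_simps(3)[OF J_Cat[OF *(1-3)]])
next
  fix X assume X: "X \<in> Obj slice_K"
  then obtain P where P: "P \<in> U" "X = over_pt P"
    by (auto simp: Obj_slice_K)
  have "Ident slice_K X = (over_pt P, (P, fctr_id (Ob P) (Mor P), P), over_pt P)"
    using slice_simps(5)[OF X] P U(1) by (simp add: Dom_over_pt structure_category_simps)
  moreover have "is_functor (jstar P) (jstar P) (fctr_id (Ob P) (Mor P))"
    using is_functor_id[OF category_jstar_U[OF P(1)]] P U(4) by simp
  ultimately show "far J (Ident slice_K X) = Ident Cat (fob J X)"
    using P U(4) by (simp add: J_simps Cat_simps(4) category_jstar_U)
next
  fix Z' Z assume "seq slice_K Z' Z"
  then obtain X f Y g W where fg: "Z = (X, f, Y)" "Z' = (Y, g, W)"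
    "(X, f, Y) \<in> Arr slice_K" "(Y, g, W) \<in> Arr slice_K"
    by (rule slice_seq)
  obtain P Q F where *: "P \<in> U" "Q \<in> U" "is_functor (jstar P) (jstar Q) F"
    "X = over_pt P" "f = (P, F, Q)" "Y = over_pt Q"
    using fg(3) by (auto simp: Arr_slice_K)
  obtain R G where **: "R \<in> U" "is_functor (jstar Q) (jstar R) G"
    "g = (Q, G, R)" "W = over_pt R"
    using fg(4) *(6) by (auto simp: Arr_slice_K over_pt_def)
  have HFG: "H P Q F" "H Q R G"
    using * ** by (simp_all add: H_iff_is_functor)
  have GF: "is_functor (jstar P) (jstar R) (fctr_comp (Ob P) (Mor P) G F)"
    using is_functor_comp[OF category_jstar_U[OF *(1)] *(3) **(2)] U(4)[OF *(1)] by simp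
  have "Comp slice_K Z' Z = (over_pt P, (P, fctr_comp (Ob P) (Mor P) G F, R), over_pt R)"
    using slice_simps(6)[OF fg(3,4)] HFG U(1) *(1,2) **(1)
    by (simp add: fg *(4-6) **(3,4) structure_category_simps)
  then show "far J (Comp slice_K Z' Z) = Comp Cat (far J Z') (far J Z)"
    using * ** GF J_Cat[OF *(1-3)] J_Cat[OF *(2) **(1,2)] U(4)[OF *(1)]
    by (simp add: fg J_simps(2) Cat_simps(5))
qed

lemma jstar_inj: "P \<in> U \<Longrightarrow> Q \<in> U \<Longrightarrow> jstar P = jstar Q \<Longrightarrow> P = Q"
  using E_jstar by (metis U(1,3))

lemma E_U: "category C \<Longrightarrow> E C \<in> U"
  using E by (simp add: U_def)

text \<open>
  On objects and on arrows a preimage under \<open>J\<close> is built with \<open>E\<close>, and it is the only one since \<open>E\<close>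
  recovers an operad from its category.
\<close>

theorem isomorphism_J: "isomorphism_of_categories slice_K Cat J"
proof (rule isomorphism_of_categories_if_bij[OF _ category_Cat is_functor_J])
  show "category slice_K"
    by (rule category.category_slice[OF category_K])
  show "bij_betw (fob J) (Obj slice_K) (Obj Cat)"
  proof (rule bij_betw_imageI)
    show "inj_on (fob J) (Obj slice_K)"
    proof (rule inj_onI)
      fix X Y assume "X \<in> Obj slice_K" "Y \<in> Obj slice_K" and eq: "fob J X = fob J Y"
      then obtain P Q where *: "P \<in> U" "X = over_pt P" "Q \<in> U" "Y = over_pt Q"
        unfolding Obj_slice_K by blast
      then show "X = Y"
        using eq jstar_inj[of P Q] by (simp add: J_simps(1))
    qed
    show "fob J ` Obj slice_K = Obj Cat"
    proof
      show "fob J ` Obj slice_K \<subseteq> Obj Cat"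
        using is_functor_J by (auto simp: is_functor_Obj)
      show "Obj Cat \<subseteq> fob J ` Obj slice_K"
      proof
        fix C :: "('o, 'm) category" assume "C \<in> Obj Cat"
        then have C: "category C"
          by (simp add: Cat_simps(1))
        show "C \<in> fob J ` Obj slice_K"
          using E_U[OF C] E(3)[OF C] J_simps(1)
          by (intro image_eqI[of _ _ "over_pt (E C)"]) (auto simp: Obj_slice_K)
      qed
    qed
  qed
  show "bij_betw (far J) (Arr slice_K) (Arr Cat)"
  proof (rule bij_betw_imageI)
    show "inj_on (far J) (Arr slice_K)"
    proof (rule inj_onI)
      fix X Y assume XY: "X \<in> Arr slice_K" "Y \<in> Arr slice_K" and eq: "far J X = far J Y"
      obtain P Q F where X: "P \<in> U" "Q \<in> U" "is_functor (jstar P) (jstar Q) F"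
        "X = (over_pt P, (P, F, Q), over_pt Q)"
        using XY(1) unfolding Arr_slice_K by blast
      obtain P' Q' F' where Y: "P' \<in> U" "Q' \<in> U" "is_functor (jstar P') (jstar Q') F'"
        "Y = (over_pt P', (P', F', Q'), over_pt Q')"
        using XY(2) unfolding Arr_slice_K by blast
      have "jstar P = jstar P'" "F = F'" "jstar Q = jstar Q'"
        using eq by (simp_all add: X Y J_simps(2))
      then show "X = Y"
        using jstar_inj[OF X(1) Y(1)] jstar_inj[OF X(2) Y(2)] by (simp add: X(4) Y(4))
    qed
    show "far J ` Arr slice_K = Arr Cat"
    proof
      show "far J ` Arr slice_K \<subseteq> Arr Cat"
        using is_functor_J by (auto simp: is_functor_Arr)
      show "Arr Cat \<subseteq> far J ` Arr slice_K"
      proof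
        fix Z :: "('o, 'm) category \<times> ('o, 'm, 'o, 'm) fctr \<times> ('o, 'm) category"
        assume "Z \<in> Arr Cat"
        then obtain C F D where Z: "Z = (C, F, D)" and C: "category C" and D: "category D"
          and F: "is_functor C D F"
          by (cases Z) (auto simp: Arr_Cat_iff)
        show "Z \<in> far J ` Arr slice_K"
          using E_U[OF C] E_U[OF D] F J_simps(2)[of "E C" "E D" F]
            Arr_slice_K_intro[of "E C" "E D" F]
          by (intro image_eqI[of _ _ "(over_pt (E C), (E C, F, E D), over_pt (E D))"])
            (simp_all add: Z E(3) C D)
      qed
    qed
  qed
qed

text \<open>
  The form in which the model structures are compared: a property \<open>R\<close> of functors of operads that
  is read off from \<open>jstar\<close> cuts out the same class as the corresponding property \<open>R'\<close> in \<open>Cat\<close>.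
\<close>

lemma image_J_class:
  assumes "\<And>P Q F. \<lbrakk>P \<in> U; Q \<in> U; is_functor (jstar P) (jstar Q) F\<rbrakk>
      \<Longrightarrow> R P F Q \<longleftrightarrow> R' (jstar P) F (jstar Q)"
  shows "far J ` {(p, f, q) \<in> Arr slice_K. f \<in> {(P, F, Q) \<in> Arr K. R P F Q}}
    = {(C, F, D) \<in> Arr Cat. R' C F D}" (is "far J ` ?A = ?B")
proof
  show "far J ` ?A \<subseteq> ?B"
    using J_Cat assms by (auto simp: Arr_slice_K J_simps(2))
  show "?B \<subseteq> far J ` ?A"
  proof
    fix Z :: "('o, 'm) category \<times> ('o, 'm, 'o, 'm) fctr \<times> ('o, 'm) category"
    assume "Z \<in> ?B"
    then obtain C F D where Z: "Z = (C, F, D)" and C: "category C" and D: "category D"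
      and F: "is_functor C D F" and R': "R' C F D"
      by (cases Z) (auto simp: Arr_Cat_iff)
    note CD = E_U[OF C] E_U[OF D]
    have F': "is_functor (jstar (E C)) (jstar (E D)) F"
      using F by (simp add: E(3) C D)
    have "(E C, F, E D) \<in> Arr K"
      using F' CD U(1) by (simp add: structure_category_simps H_iff_is_functor)
    then show "Z \<in> far J ` ?A"
      using J_simps(2)[OF CD F'] Arr_slice_K_intro[OF CD F'] assms[OF CD F'] R'
      by (intro image_eqI[of _ _ "(over_pt (E C), (E C, F, E D), over_pt (E D))"])
        (simp_all add: Z E(3) C D)
  qed
qed

definition M :: "(('o, 'm, 'x) operad_scheme \<times> ('o, 'm, 'o, 'm) fctr
    \<times> ('o, 'm, 'x) operad_scheme) model_classes" where
  "M =
     \<lparr>weq = {(P, F, Q) \<in> Arr K. operad_weq P Q F},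
      cof = {(P, F, Q) \<in> Arr K. inj_on (fob F) (Ob P)},
      fib = {(P, F, Q) \<in> Arr K. operad_fib P Q F}\<rparr>"

theorem image_J_M: "image_classes J (slice_classes K pt M) = Rezk_classes"
proof -
  have "far J ` weq (slice_classes K pt M) = weq Rezk_classes"
    unfolding slice_classes_def M_def Rezk_classes_def model_classes.simps
    by (rule image_J_class) (simp add: U operad_weq_iff_equivalence)
  moreover have "far J ` cof (slice_classes K pt M) = cof Rezk_classes"
    unfolding slice_classes_def M_def Rezk_classes_def model_classes.simps
    by (rule image_J_class) simp
  moreover have "far J ` fib (slice_classes K pt M) = fib Rezk_classes"
    unfolding slice_classes_def M_def Rezk_classes_def model_classes.simps
    by (rule image_J_class) (simp add: U operad_fib_iff_isofibration)
  ultimately show ?thesis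
    unfolding image_classes_def by simp
qed

theorem slice_model_structure_is_Rezk:
  "isomorphism_of_categories slice_K Cat J
   \<and> image_classes J (slice_classes K pt M) = Rezk_classes
   \<and> (model_structure K M
      \<longrightarrow> model_structure slice_K (slice_classes K pt M) \<and> model_structure Cat
        (Rezk_classes :: (('o, 'm) category \<times> ('o, 'm, 'o, 'm) fctr \<times> ('o, 'm) category) model_classes))"
  using isomorphism_J image_J_M model_structure.model_structure_slice
    model_structure_image[OF isomorphism_J] by metis

end

section \<open>The categories of operads and of symmetric operads\<close>

lemma operad_functor_id:
  assumes "operad P"
  shows "operad_functor P P (fctr_id (Ob P) (Mor P))"
proof -
  interpret operad P by fact
  have s: "map (\<lambda>x\<in>Ob P. x) (src P f) = src P f" if "f \<in> Mor P" for f
    using that src by (intro map_idI) (auto simp: PiE_iff Pi_iff in_lists_conv_set)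
  have t: "tgt P f \<in> Ob P" if "f \<in> Mor P" for f
    using that tgt by auto
  have c: "cmp P f gs \<in> Mor P \<and> f \<in> Mor P \<and> map (\<lambda>f\<in>Mor P. f) gs = gs" if "mseq P f gs" for f gs
    using that cmp[OF that] by (auto simp: mseq_def MHom_def intro!: map_idI)
  show ?thesis
    unfolding operad_functor_def using s t c idn by (auto simp: MHom_def)
qed

lemma operad_functor_comp:
  assumes "operad P" and F: "operad_functor P Q F" and G: "operad_functor Q R G"
  shows "operad_functor P R (fctr_comp (Ob P) (Mor P) G F)"
proof -
  interpret operad P by fact
  have s: "set (src P f) \<subseteq> Ob P" "tgt P f \<in> Ob P" if "f \<in> Mor P" for f
    using that src tgt by (auto simp: PiE_iff Pi_iff in_lists_conv_set)
  have c: "cmp P f gs \<in> Mor P" "f \<in> Mor P" "set gs \<subseteq> Mor P"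
    "mseq Q (far F f) (map (far F) gs)" if "mseq P f gs" for f gs
  proof -
    show *: "f \<in> Mor P" "set gs \<subseteq> Mor P"
      using that by (simp_all add: mseq_def)
    show "cmp P f gs \<in> Mor P"
      using cmp[OF that] by (simp add: MHom_def)
    have "map (tgt Q) (map (far F) gs) = map (fob F) (map (tgt P) gs)"
      using * F by (auto simp: operad_functor_def)
    also have "\<dots> = src Q (far F f)"
      using that F by (simp add: mseq_def operad_functor_def)
    finally show "mseq Q (far F f) (map (far F) gs)"
      using * F by (auto simp: mseq_def operad_functor_def)
  qed
  show ?thesis
    unfolding operad_functor_def
  proof (intro conjI ballI allI impI)
    let ?GF = "fctr_comp (Ob P) (Mor P) G F"
    show "fob ?GF \<in> Ob P \<rightarrow>\<^sub>E Ob R" "far ?GF \<in> Mor P \<rightarrow>\<^sub>E Mor R"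
      using F G by (auto simp: operad_functor_def)
    show "src R (far ?GF f) = map (fob ?GF) (src P f)" "tgt R (far ?GF f) = fob ?GF (tgt P f)"
      if f: "f \<in> Mor P" for f
    proof -
      have "far F f \<in> Mor Q"
        using F f by (auto simp: operad_functor_def)
      then show "src R (far ?GF f) = map (fob ?GF) (src P f)"
        "tgt R (far ?GF f) = fob ?GF (tgt P f)"
        using F G f s[OF f] by (auto simp: operad_functor_def)
    qed
    show "far ?GF (idn P p) = idn R (fob ?GF p)" if p: "p \<in> Ob P" for p
      using F G p idn[OF p] by (auto simp: operad_functor_def MHom_def)
    show "far ?GF (cmp P f gs) = cmp R (far ?GF f) (map (far ?GF) gs)" if m: "mseq P f gs" for f gs
    proof -
      have "map (far ?GF) gs = map (far G) (map (far F) gs)"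
        using c(3)[OF m] by auto
      moreover have "far F (cmp P f gs) = cmp Q (far F f) (map (far F) gs)"
        using F m by (simp add: operad_functor_def)
      moreover have "far G (cmp Q (far F f) (map (far F) gs))
          = cmp R (far G (far F f)) (map (far G) (map (far F) gs))"
        using G c(4)[OF m] unfolding operad_functor_def by blast
      ultimately show ?thesis
        using c(1,2)[OF m] by (simp del: map_map map_eq_conv)
    qed
  qed
qed

lemma category_Ope: "category (structure_category {P :: ('o, 'm) operad. operad P} Ob Mor operad_functor)"
proof (rule category_structure_category)
  fix P Q :: "('o, 'm) operad" and F :: "('o, 'm, 'o, 'm) fctr"
  assume "operad_functor P Q F"
  then show "fob F \<in> Ob P \<rightarrow>\<^sub>E Ob Q \<and> far F \<in> Mor P \<rightarrow>\<^sub>E Mor Q"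
    by (simp add: operad_functor_def)
qed (auto intro: operad_functor_id operad_functor_comp)

lemma category_Ope_Sigma:
  "category (structure_category {P :: ('o, 'm) sym_operad. sym_operad P} Ob Mor sym_operad_functor)"
proof (rule category_structure_category)
  fix P Q :: "('o, 'm) sym_operad" and F :: "('o, 'm, 'o, 'm) fctr"
  assume "sym_operad_functor P Q F"
  then show "fob F \<in> Ob P \<rightarrow>\<^sub>E Ob Q \<and> far F \<in> Mor P \<rightarrow>\<^sub>E Mor Q"
    by (simp add: sym_operad_functor_def operad_functor_def)
next
  fix P :: "('o, 'm) sym_operad" assume "P \<in> {P. sym_operad P}"
  then interpret sym_operad P by simp
  show "sym_operad_functor P P (fctr_id (Ob P) (Mor P))"
    unfolding sym_operad_functor_def
    using operad_functor_id[OF operad_axioms] act by (auto simp: acts_def MHom_def)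
next
  fix P Q R :: "('o, 'm) sym_operad" and F G :: "('o, 'm, 'o, 'm) fctr"
  assume P: "P \<in> {P. sym_operad P}"
    and F: "sym_operad_functor P Q F" and G: "sym_operad_functor Q R G"
  interpret sym_operad P using P by simp
  have "far (fctr_comp (Ob P) (Mor P) G F) (act P \<sigma> f)
      = act R \<sigma> (far (fctr_comp (Ob P) (Mor P) G F) f)" if a: "acts P \<sigma> f" for \<sigma> f
  proof -
    have "acts Q \<sigma> (far F f)"
      using a F by (auto simp: acts_def arity_def sym_operad_functor_def operad_functor_def)
    then show ?thesis
      using a act[OF a] F G by (auto simp: sym_operad_functor_def MHom_def acts_def)
  qed
  then show "sym_operad_functor P R (fctr_comp (Ob P) (Mor P) G F)"
    unfolding sym_operad_functor_def
    using operad_functor_comp[OF operad_axioms] F G by (auto simp: sym_operad_functor_def)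
qed

definition point_category :: "'o \<Rightarrow> 'm \<Rightarrow> ('o, 'm) category" where
  "point_category a u =
     \<lparr>Obj = {a}, Arr = {u}, Dom = (\<lambda>f\<in>{u}. a), Cod = (\<lambda>f\<in>{u}. a), Ident = (\<lambda>p\<in>{a}. u),
      Comp = (\<lambda>g f. if g = u \<and> f = u then u else undefined)\<rparr>"

lemma category_point_category: "category (point_category a u)"
  by unfold_locales (auto simp: point_category_def Hom_def seq_def)

lemma star_eq: "star a u = operad_of_category (point_category a u)"
  by (auto simp: star_def operad_of_category_def point_category_def fun_eq_iff split: list.splits)

lemma sym_star_eq: "sym_star a u = sym_operad_of_category (point_category a u)"
proof -
  have "(\<lambda>\<sigma> f. if f = u \<and> \<sigma> permutes {..<1} then u else undefined)
      = (\<lambda>\<sigma> f. if f \<in> Arr (point_category a u) \<and> \<sigma> permutes {..<1::nat} then f else undefined)"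
    by (auto simp: point_category_def fun_eq_iff)
  then show ?thesis
    by (simp add: sym_star_def sym_operad_of_category_def star_eq)
qed

lemma star_simps:
  "operad (star a u)" "all_unary (star a u)" "Ob (star a u) = {a}" "Mor (star a u) = {u}"
  by (simp_all add: star_eq operad_operad_of_category all_unary_operad_of_category
      category_point_category) (simp_all add: point_category_def)

lemma all_unary_sym_operad_of_category: "all_unary (sym_operad_of_category C)"
  by (simp add: sym_operad_of_category_def all_unary_operad_of_category)

lemma jstar_sym_operad_of_category: "category C \<Longrightarrow> jstar (sym_operad_of_category C) = C"
  by (simp add: sym_operad_of_category_def jstar_operad_of_category)

lemma sym_star_simps:
  "sym_operad (sym_star a u)" "all_unary (sym_star a u)"
  "Ob (sym_star a u) = {a}" "Mor (sym_star a u) = {u}"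
proof -
  show "sym_operad (sym_star a u)"
    by (simp add: sym_star_eq sym_operad_sym_operad_of_category category_point_category)
qed (simp_all add: sym_star_def star_simps)

interpretation Ope: operads_over_point
  "{P. operad P}" operad_functor operad_of_category "star a u" a u for a :: 'o and u :: 'm
proof (rule operads_over_point.intro)
  show "category (structure_category {P :: ('o, 'm) operad. operad P} Ob Mor operad_functor)"
    by (rule category_Ope)
  show "operad_of_category (jstar P) = P" if "P \<in> {P. operad P}" "all_unary P"
    for P :: "('o, 'm) operad"
    using that by (simp add: operad_of_category_jstar operad.truncate_def)
qed (simp_all add: operad_operad_of_category all_unary_operad_of_category
    jstar_operad_of_category star_simps)

interpretation Ope_Sigma: operads_over_point
  "{P. sym_operad P}" sym_operad_functor sym_operad_of_category "sym_star a u" a u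
  for a :: 'o and u :: 'm
proof (rule operads_over_point.intro)
  show "category (structure_category {P :: ('o, 'm) sym_operad. sym_operad P} Ob Mor
      sym_operad_functor)"
    by (rule category_Ope_Sigma)
  show "operad P" if "P \<in> {P. sym_operad P}" for P :: "('o, 'm) sym_operad"
    using that by (simp add: sym_operad_def)
  show "operad_functor P Q F" if "sym_operad_functor P Q F"
    for P Q :: "('o, 'm) sym_operad" and F
    using that by (simp add: sym_operad_functor_def)
qed (simp_all add: sym_operad_sym_operad_of_category all_unary_sym_operad_of_category
    jstar_sym_operad_of_category sym_operad_of_category_jstar
    sym_operad_functor_if_operad_functor sym_star_simps)

lemma Ope_M: "Ope.M = Ope_classes"
  by (simp add: Ope.M_def Ope_classes_def Ope_def)

lemma Ope_Sigma_M: "Ope_Sigma.M = Ope_Sigma_classes"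
  by (simp add: Ope_Sigma.M_def Ope_Sigma_classes_def Ope_Sigma_def)

theorem theorem2p5:
  fixes a :: 'o and u :: 'm
  shows
    "(isomorphism_of_categories (slice Ope (star a u)) Cat (slice_jstar Ope (star a u))
      \<and> image_classes (slice_jstar Ope (star a u)) (slice_classes Ope (star a u) Ope_classes)
          = Rezk_classes
      \<and> (model_structure Ope (Ope_classes ::
            (('o, 'm) operad \<times> ('o, 'm, 'o, 'm) fctr \<times> ('o, 'm) operad) model_classes)
         \<longrightarrow> model_structure (slice Ope (star a u)) (slice_classes Ope (star a u) Ope_classes)
           \<and> model_structure Cat (Rezk_classes ::
            (('o, 'm) category \<times> ('o, 'm, 'o, 'm) fctr \<times> ('o, 'm) category) model_classes)))
     \<and> (isomorphism_of_categories (slice Ope_Sigma (sym_star a u)) Cat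
          (slice_jstar Ope_Sigma (sym_star a u))
      \<and> image_classes (slice_jstar Ope_Sigma (sym_star a u))
          (slice_classes Ope_Sigma (sym_star a u) Ope_Sigma_classes) = Rezk_classes
      \<and> (model_structure Ope_Sigma (Ope_Sigma_classes ::
            (('o, 'm) sym_operad \<times> ('o, 'm, 'o, 'm) fctr \<times> ('o, 'm) sym_operad) model_classes)
         \<longrightarrow> model_structure (slice Ope_Sigma (sym_star a u))
               (slice_classes Ope_Sigma (sym_star a u) Ope_Sigma_classes)
           \<and> model_structure Cat (Rezk_classes ::
            (('o, 'm) category \<times> ('o, 'm, 'o, 'm) fctr \<times> ('o, 'm) category) model_classes)))"
  using Ope.slice_model_structure_is_Rezk[of a u, folded Ope_def, unfolded Ope_M]
    Ope_Sigma.slice_model_structure_is_Rezk[of a u, folded Ope_Sigma_def, unfolded Ope_Sigma_M]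
  by (rule conjI)

end
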